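(* Let $\sigma:\mathcal{A}^*\to\mathcal{B}^*$ be a non-erasing morphism of free monoids on finite non-empty alphabets, and let $X\subseteq\mathcal{A}^{\mathbb{Z}}$ be any subshift. If the map induced by $\sigma$ on the shift-orbits of $X$, $\mathcal{O}(\mathbf{x})\mapsto\mathcal{O}(\sigma^{\mathbb{Z}}(\mathbf{x}))$ for $\mathbf{x}\in X$, is injective, then the measure transfer map $\sigma_X^{\mathcal{M}}:\mathcal{M}(X)\to\mathcal{M}(\sigma(X))$ is injective.
   Context: For a finite non-empty alphabet $\mathcal{A}$, $\mathcal{A}^*$ is the free monoid of finite words, $|w|$ is word length. The full shift $\mathcal{A}^{\mathbb{Z}}$ carries the product topology and the shift $T$, $(T\mathbf{x})_k=x_{k+1}$; the shift-orbit of $\mathbf{x}$ is $\mathcal{O}(\mathbf{x})=\{T^n(\mathbf{x}):n\in\mathbb{Z}\}$. The cylinder of $w$ is $[w]=\{\mathbf{x}: x_1\cdots x_{|w|}=w\}$. A subshift is a non-empty closed subset $X\subseteq\mathcal{A}^{\mathbb{Z}}$ with $T(X)=X$. A monoid morphism $\sigma:\mathcal{A}^*\to\mathcal{B}^*$ is non-erasing if $|\sigma(a)|\ge1$ for all $a\in\mathcal{A}$. It induces $\sigma^{\mathbb{Z}}:\mathcal{A}^{\mathbb{Z}}\to\mathcal{B}^{\mathbb{Z}}$ by concatenating the words $\sigma(x_i)$, with $\sigma(x_1)$ starting at position $1$. The image subshift $\sigma(X)$ is the intersection of all subshifts of $\mathcal{B}^{\mathbb{Z}}$ containing $\sigma^{\mathbb{Z}}(X)$.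 An invariant measure on $X$ is a finite $T$-invariant Borel measure on $\mathcal{A}^{\mathbb{Z}}$ with support in $X$; $\mathcal{M}(X)$ is the set of those. Measure transfer: for non-erasing $\sigma$ let $\mathcal{A}_\sigma$ be the alphabet of letters $a(k)$ with $a\in\mathcal{A}$, $1\le k\le|\sigma(a)|$; let $\pi_\sigma:\mathcal{A}^*\to\mathcal{A}_\sigma^*$, $a\mapsto a(1)a(2)\cdots a(|\sigma(a)|)$, and let $\alpha_\sigma:\mathcal{A}_\sigma^*\to\mathcal{B}^*$ send $a(k)$ to the $k$-th letter of $\sigma(a)$, so that $\sigma=\alpha_\sigma\circ\pi_\sigma$. For a non-empty word $u\in\mathcal{A}_\sigma^*$ let $\hat u\in\mathcal{A}^*$ be the shortest word such that $u$ is a factor (contiguous subword) of $\pi_\sigma(\hat u)$ (it is unique if it exists); if no such word exists, put formally $\mu([\hat u])=0$. For $\mu\in\mathcal{M}(\mathcal{A}^{\mathbb{Z}})$, the transferred measure $\mu^\sigma=\sigma^{\mathcal{M}}(\mu)\in\mathcal{M}(\mathcal{B}^{\mathbb{Z}})$ is the invariant measure determined by $\mu^\sigma([w])=\sum_{u\in\alpha_\sigma^{-1}(w)}\mu([\hat u])$ for all non-empty $w\in\mathcal{B}^*$. The map $\sigma_X^{\mathcal{M}}:\mathcal{M}(X)\to\mathcal{M}(\sigma(X))$ is the restriction $\mu\mapsto\mu^\sigma$ (which is known to take values in $\mathcal{M}(\sigma(X))$). *)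

theory Defs
  imports "HOL-Analysis.Analysis" "HOL-Library.Sublist"
begin

text \<open>
  Alphabets are types of class \<open>finite\<close>, finite words are lists, and the full shift
  over the alphabet \<open>'a\<close> is the type \<open>int \<Rightarrow> 'a\<close>.
\<close>

definition full_shift :: "(int \<Rightarrow> 'a) topology" where
  "full_shift = product_topology (\<lambda>_. discrete_topology UNIV) UNIV"

definition shift :: "(int \<Rightarrow> 'a) \<Rightarrow> int \<Rightarrow> 'a" where
  "shift x = (\<lambda>k. x (k + 1))"

definition shift_orbit :: "(int \<Rightarrow> 'a) \<Rightarrow> (int \<Rightarrow> 'a) set" where
  "shift_orbit x = range (\<lambda>(n::int) k. x (k + n))"

definition cylinder :: "'a list \<Rightarrow> (int \<Rightarrow> 'a) set" where
  "cylinder w = {x. map x [1..int (length w)] = w}"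

definition subshift :: "(int \<Rightarrow> 'a) set \<Rightarrow> bool" where
  "subshift X \<longleftrightarrow> X \<noteq> {} \<and> closedin full_shift X \<and> shift ` X = X"

definition monoid_morphism :: "('a list \<Rightarrow> 'b list) \<Rightarrow> bool" where
  "monoid_morphism \<sigma> \<longleftrightarrow> \<sigma> [] = [] \<and> (\<forall>u v. \<sigma> (u @ v) = \<sigma> u @ \<sigma> v)"

definition non_erasing :: "('a list \<Rightarrow> 'b list) \<Rightarrow> bool" where
  "non_erasing \<sigma> \<longleftrightarrow> (\<forall>a. 1 \<le> length (\<sigma> [a]))"

text \<open>
  \<open>block_start \<sigma> x n\<close> is the position at which the block \<open>\<sigma> [x n]\<close> starts in the
  bi-infinite concatenation. At most one of the two sums is non-empty; the second one
  takes care of \<open>n < 1\<close>.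
\<close>

definition block_start :: "('a list \<Rightarrow> 'b list) \<Rightarrow> (int \<Rightarrow> 'a) \<Rightarrow> int \<Rightarrow> int" where
  "block_start \<sigma> x n =
     1 + (\<Sum>i\<in>{1..<n}. int (length (\<sigma> [x i]))) - (\<Sum>i\<in>{n..<1}. int (length (\<sigma> [x i])))"

definition morphism_Z :: "('a list \<Rightarrow> 'b list) \<Rightarrow> (int \<Rightarrow> 'a) \<Rightarrow> int \<Rightarrow> 'b" where
  "morphism_Z \<sigma> x j =
     (let n = (THE n. block_start \<sigma> x n \<le> j \<and> j < block_start \<sigma> x (n + 1))
      in \<sigma> [x n] ! nat (j - block_start \<sigma> x n))"

definition image_subshift :: "('a list \<Rightarrow> 'b list) \<Rightarrow> (int \<Rightarrow> 'a) set \<Rightarrow> (int \<Rightarrow> 'b) set" where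
  "image_subshift \<sigma> X = \<Inter> {Y. subshift Y \<and> morphism_Z \<sigma> ` X \<subseteq> Y}"

text \<open>
  The map on shift-orbits sending the orbit of \<open>x\<close> to the orbit of \<open>morphism_Z \<sigma> x\<close>;
  the lemma \<open>orbit_map_shift_orbit\<close> below shows that it is well defined.
\<close>

definition orbit_map :: "('a list \<Rightarrow> 'b list) \<Rightarrow> (int \<Rightarrow> 'a) set \<Rightarrow> (int \<Rightarrow> 'b) set" where
  "orbit_map \<sigma> \<Omega> =
     (THE \<Omega>'. \<exists>x. \<Omega> = shift_orbit x \<and> \<Omega>' = shift_orbit (morphism_Z \<sigma> x))"

definition borel_shift :: "(int \<Rightarrow> 'a) measure" where
  "borel_shift = sigma UNIV {U. openin full_shift U}"

definition measure_support :: "(int \<Rightarrow> 'a) measure \<Rightarrow> (int \<Rightarrow> 'a) set" where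
  "measure_support \<mu> = {x. \<forall>U. openin full_shift U \<and> x \<in> U \<longrightarrow> emeasure \<mu> U > 0}"

definition invariant_measures :: "(int \<Rightarrow> 'a) set \<Rightarrow> (int \<Rightarrow> 'a) measure set" where
  "invariant_measures X =
     {\<mu>. sets \<mu> = sets borel_shift \<and> finite_measure \<mu> \<and>
         (\<forall>A\<in>sets \<mu>. emeasure \<mu> (shift -` A) = emeasure \<mu> A) \<and>
         measure_support \<mu> \<subseteq> X}"

text \<open>The letter \<open>a(k)\<close> of the subdivided alphabet is the pair \<open>(a, k)\<close>, with \<open>k\<close> counted from 1.\<close>

definition subdiv_alphabet :: "('a list \<Rightarrow> 'b list) \<Rightarrow> ('a \<times> nat) set" where
  "subdiv_alphabet \<sigma> = {(a, k). 1 \<le> k \<and> k \<le> length (\<sigma> [a])}"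

definition subdiv_morphism :: "('a list \<Rightarrow> 'b list) \<Rightarrow> 'a list \<Rightarrow> ('a \<times> nat) list" where
  "subdiv_morphism \<sigma> v = concat (map (\<lambda>a. map (Pair a) [1..<Suc (length (\<sigma> [a]))]) v)"

definition letter_morphism :: "('a list \<Rightarrow> 'b list) \<Rightarrow> ('a \<times> nat) list \<Rightarrow> 'b list" where
  "letter_morphism \<sigma> u = map (\<lambda>(a, k). \<sigma> [a] ! (k - 1)) u"

definition hat_word :: "('a list \<Rightarrow> 'b list) \<Rightarrow> ('a \<times> nat) list \<Rightarrow> 'a list" where
  "hat_word \<sigma> u = (ARG_MIN length v. sublist u (subdiv_morphism \<sigma> v))"

definition hat_mass ::
    "('a list \<Rightarrow> 'b list) \<Rightarrow> (int \<Rightarrow> 'a) measure \<Rightarrow> ('a \<times> nat) list \<Rightarrow> ennreal" where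
  "hat_mass \<sigma> \<mu> u =
     (if \<exists>v. sublist u (subdiv_morphism \<sigma> v) then emeasure \<mu> (cylinder (hat_word \<sigma> u)) else 0)"

definition measure_transfer ::
    "('a list \<Rightarrow> 'b list) \<Rightarrow> (int \<Rightarrow> 'a) measure \<Rightarrow> (int \<Rightarrow> 'b) measure" where
  "measure_transfer \<sigma> \<mu> =
     (THE \<nu>. \<nu> \<in> invariant_measures UNIV \<and>
        (\<forall>w. w \<noteq> [] \<longrightarrow>
           emeasure \<nu> (cylinder w) =
             (\<Sum>u \<in> {u \<in> lists (subdiv_alphabet \<sigma>). letter_morphism \<sigma> u = w}. hat_mass \<sigma> \<mu> u)))"

lemma letter_subdiv_morphism:
  assumes "monoid_morphism \<sigma>"
  shows "letter_morphism \<sigma> (subdiv_morphism \<sigma> v) = \<sigma> v"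
proof (induction v)
  case Nil
  then show ?case
    using assms by (simp add: letter_morphism_def subdiv_morphism_def monoid_morphism_def)
next
  case (Cons a v)
  have "map ((\<lambda>(a, k). \<sigma> [a] ! (k - 1)) \<circ> Pair a) [1..<Suc (length (\<sigma> [a]))] = \<sigma> [a]"
    by (rule nth_equalityI) (simp_all del: upt_Suc)
  moreover have "\<sigma> (a # v) = \<sigma> [a] @ \<sigma> v"
    using assms unfolding monoid_morphism_def by (metis append_Cons append_Nil)
  ultimately show ?case
    using Cons by (simp add: letter_morphism_def subdiv_morphism_def del: upt_Suc)
qed

lemma block_start_1 [simp]: "block_start \<sigma> x 1 = 1"
  by (simp add: block_start_def)

lemma block_start_Suc: "block_start \<sigma> x (n + 1) = block_start \<sigma> x n + int (length (\<sigma> [x n]))"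
proof (cases "n \<ge> 1")
  case True
  then have "{1..<n + 1} = insert n {1..<n}" by auto
  with True show ?thesis by (simp add: block_start_def)
next
  case False
  then have "{n..<1} = insert n {n + 1..<1}" by auto
  with False show ?thesis by (simp add: block_start_def)
qed

lemma block_start_shift:
  "block_start \<sigma> (\<lambda>k. x (k + m)) n = block_start \<sigma> x (n + m) - block_start \<sigma> x (1 + m) + 1"
proof (induction n rule: int_induct [where k = 1])
  case base
  then show ?case by simp
next
  case (step1 i)
  then show ?case
    using block_start_Suc[of \<sigma> "\<lambda>k. x (k + m)" i] block_start_Suc[of \<sigma> x "i + m"]
    by (simp add: algebra_simps)
next
  case (step2 i)
  then show ?case
    using block_start_Suc[of \<sigma> "\<lambda>k. x (k + m)" "i - 1"] block_start_Suc[of \<sigma> x "i - 1 + m"]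
    by (simp add: algebra_simps)
qed

lemma block_start_gap:
  assumes "non_erasing \<sigma>" "m \<le> n"
  shows "n - m \<le> block_start \<sigma> x n - block_start \<sigma> x m"
  using assms(2)
proof (induction n rule: int_ge_induct)
  case base
  then show ?case by simp
next
  case (step i)
  have "1 \<le> length (\<sigma> [x i])" using assms(1) by (simp add: non_erasing_def)
  then show ?case using step block_start_Suc[of \<sigma> x i] by linarith
qed

lemma block_unique:
  assumes "non_erasing \<sigma>"
    and "block_start \<sigma> x n \<le> j" "j < block_start \<sigma> x (n + 1)"
    and "block_start \<sigma> x m \<le> j" "j < block_start \<sigma> x (m + 1)"
  shows "n = m"
proof (rule ccontr)
  assume "n \<noteq> m"
  then consider "n + 1 \<le> m" | "m + 1 \<le> n" by linarith
  then show False
    using block_start_gap[OF assms(1), of "n + 1" m x] block_start_gap[OF assms(1), of "m + 1" n x]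
      assms(2-5) by cases linarith+
qed

lemma block_exists:
  assumes "non_erasing \<sigma>"
  shows "\<exists>n. block_start \<sigma> x n \<le> j \<and> j < block_start \<sigma> x (n + 1)"
proof -
  define lo where "lo = min 1 j"
  have lo: "block_start \<sigma> x lo \<le> j"
    using block_start_gap[OF assms, of lo 1 x] by (cases "1 \<le> j") (simp_all add: lo_def min_def)
  define P where "P k \<longleftrightarrow> j < block_start \<sigma> x (lo + int k)" for k
  define hi where "hi = max 1 j + 1"
  have "1 \<le> hi" "j < hi" "lo \<le> hi" by (auto simp: hi_def lo_def)
  then have "P (nat (hi - lo))"
    using block_start_gap[OF assms, of 1 hi x] by (simp add: P_def)
  then have ex: "\<exists>k. P k" by blast
  define k where "k = (LEAST k. P k)"
  have Pk: "P k" unfolding k_def using ex by (rule LeastI_ex)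
  have "k \<noteq> 0" using Pk lo by (auto simp: P_def intro: gr0I)
  then obtain l where l: "k = Suc l" using not0_implies_Suc by blast
  have "\<not> P l" using l not_less_Least[of l P] by (simp add: k_def)
  then show ?thesis
    using Pk l by (intro exI[of _ "lo + int l"]) (simp add: P_def algebra_simps)
qed

lemma morphism_Z_block:
  assumes "non_erasing \<sigma>" and "i < length (\<sigma> [x n])"
  shows "morphism_Z \<sigma> x (block_start \<sigma> x n + int i) = \<sigma> [x n] ! i"
proof -
  let ?j = "block_start \<sigma> x n + int i"
  have n: "block_start \<sigma> x n \<le> ?j \<and> ?j < block_start \<sigma> x (n + 1)"
    using assms(2) by (simp add: block_start_Suc)
  then have "(THE n. block_start \<sigma> x n \<le> ?j \<and> ?j < block_start \<sigma> x (n + 1)) = n"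
    by (intro the_equality) (auto intro: block_unique[OF assms(1)])
  then show ?thesis by (simp add: morphism_Z_def)
qed

lemma morphism_Z_shift:
  assumes "non_erasing \<sigma>"
  shows "morphism_Z \<sigma> (\<lambda>k. x (k + m)) = (\<lambda>j. morphism_Z \<sigma> x (j + (block_start \<sigma> x (1 + m) - 1)))"
proof
  fix j
  let ?y = "\<lambda>k. x (k + m)"
  obtain n where n: "block_start \<sigma> ?y n \<le> j" "j < block_start \<sigma> ?y (n + 1)"
    using block_exists[OF assms] by blast
  define i where "i = nat (j - block_start \<sigma> ?y n)"
  have j: "j = block_start \<sigma> ?y n + int i" using n by (simp add: i_def)
  have i: "i < length (\<sigma> [?y n])" using n j by (simp add: block_start_Suc)
  have "j + (block_start \<sigma> x (1 + m) - 1) = block_start \<sigma> x (n + m) + int i"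
    using j block_start_shift[of \<sigma> x m n] by linarith
  then have "morphism_Z \<sigma> x (j + (block_start \<sigma> x (1 + m) - 1)) = \<sigma> [x (n + m)] ! i"
    using morphism_Z_block[OF assms, of i x "n + m"] i by simp
  moreover have "morphism_Z \<sigma> ?y j = \<sigma> [x (n + m)] ! i"
    using morphism_Z_block[OF assms, of i ?y n] i by (simp only: j [symmetric])
  ultimately show "morphism_Z \<sigma> ?y j = morphism_Z \<sigma> x (j + (block_start \<sigma> x (1 + m) - 1))"
    by simp
qed

lemma shift_orbit_translate: "shift_orbit (\<lambda>k. x (k + m)) = shift_orbit x"
proof -
  have "range (\<lambda>(n::int) k. x (k + n + m)) = range (\<lambda>(n::int) k. x (k + n))"
  proof (intro equalityI subsetI)
    fix y assume "y \<in> range (\<lambda>(n::int) k. x (k + n + m))"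
    then obtain n where "y = (\<lambda>k. x (k + n + m))" by blast
    then have "y = (\<lambda>k. x (k + (n + m)))" by (simp add: add.assoc)
    then show "y \<in> range (\<lambda>(n::int) k. x (k + n))" by blast
  next
    fix y assume "y \<in> range (\<lambda>(n::int) k. x (k + n))"
    then obtain n where "y = (\<lambda>k. x (k + n))" by blast
    then have "y = (\<lambda>k. x (k + (n - m) + m))" by simp
    then show "y \<in> range (\<lambda>(n::int) k. x (k + n + m))" by blast
  qed
  then show ?thesis by (simp add: shift_orbit_def)
qed

lemma orbit_map_shift_orbit:
  assumes "non_erasing \<sigma>"
  shows "orbit_map \<sigma> (shift_orbit x) = shift_orbit (morphism_Z \<sigma> x)"
proof -
  have "shift_orbit (morphism_Z \<sigma> y) = shift_orbit (morphism_Z \<sigma> x)"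
    if "shift_orbit x = shift_orbit y" for y
  proof -
    have "y \<in> shift_orbit y" unfolding shift_orbit_def by (rule range_eqI[of _ _ 0]) simp
    then have "y \<in> shift_orbit x" using that by simp
    then obtain m where y: "y = (\<lambda>k. x (k + m))" unfolding shift_orbit_def by blast
    show ?thesis
      unfolding y morphism_Z_shift[OF assms, of x m] by (rule shift_orbit_translate)
  qed
  then show ?thesis unfolding orbit_map_def by (intro the_equality) blast+
qed

end

theory Submission
  imports Defs
begin

text \<open>
  The transferred measure has a geometric description: it is the push-forward of \<open>\<mu>\<close>, spread over
  the tower of pairs \<open>(x, k)\<close> with \<open>k < |\<sigma>(x\<^sub>1)|\<close>, under the map that sends \<open>(x, k)\<close> to the
  \<open>k\<close>-fold shift of the image of \<open>x\<close>. The tower description yields invariance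
  (\<open>tower_count_shift\<close>) and the support (\<open>tower_measure_support\<close>). Reading subdivided words from
  tower points gives the defining cylinder formula: each word \<open>u\<close> is read above \<open>x\<close> from at most
  one level, and it is read there iff \<open>x\<close> lies in the cylinder of the hat word of \<open>u\<close>
  (\<open>subdiv_reads_iff\<close>). Since an invariant measure is determined by its values on cylinders, the
  transferred measure exists and equals the tower measure.

  For injectivity, let the tower measures of \<open>\<mu>\<close> and \<open>\<nu>\<close> be equal. By orbit
  injectivity, a tower point over \<open>X\<close> whose image is the image of some \<open>y \<in> X\<close> must be \<open>(y, 0)\<close>,
  provided that this image is aperiodic (\<open>aperiodic_fibre\<close>). So if \<open>K\<close> is a
  closed subset of \<open>X\<close>, the image of \<open>K\<close> minus the periodic points is a Borel set whose
  transferred mass is the mass of the part of \<open>K\<close> with aperiodic image (\<open>aperiodic_part\<close>); hence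
  \<open>\<mu>\<close> and \<open>\<nu>\<close> agree on that part. Only countably many points of \<open>X\<close> have a periodic image, and
  the mass of each single point \<open>x\<close> is recovered from the transferred mass of the orbit of its image
  (\<open>singletons_eq\<close>). Adding both parts for \<open>K\<close> a cylinder intersected with \<open>X\<close> gives \<open>\<mu> = \<nu>\<close>.
\<close>

section \<open>The topology of the full shift\<close>

text \<open>
Two points agree up to \<open>N\<close> when no coordinate in the central window \<open>{-N..N}\<close> tells them
apart. These relations are the basic entourages of the full shift, so topological statements
about it become statements about finitely many coordinates.
\<close>

definition agree :: "nat \<Rightarrow> (int \<Rightarrow> 'a) \<Rightarrow> (int \<Rightarrow> 'a) \<Rightarrow> bool" where
  "agree N x y \<longleftrightarrow> (\<forall>k. \<bar>k\<bar> \<le> int N \<longrightarrow> x k = y k)"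

lemma agree_refl [simp]: "agree N x x"
  by (simp add: agree_def)

lemma agree_sym: "agree N x y \<Longrightarrow> agree N y x"
  by (simp add: agree_def)

lemma agree_trans: "agree N x y \<Longrightarrow> agree N y z \<Longrightarrow> agree N x z"
  by (simp add: agree_def)

lemma agree_mono: "agree N x y \<Longrightarrow> M \<le> N \<Longrightarrow> agree M x y"
  by (simp add: agree_def)

lemma topspace_full_shift [simp]: "topspace full_shift = UNIV"
  by (simp add: full_shift_def PiE_UNIV_domain)

lemma openin_full_shift_iff:
  "openin full_shift U \<longleftrightarrow> (\<forall>x\<in>U. \<exists>N. \<forall>y. agree N x y \<longrightarrow> y \<in> U)"
proof
  assume op: "openin full_shift U"
  show "\<forall>x\<in>U. \<exists>N. \<forall>y. agree N x y \<longrightarrow> y \<in> U"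
  proof
    fix x assume "x \<in> U"
    then obtain V where fin: "finite {i. V i \<noteq> UNIV}" and x: "x \<in> Pi\<^sub>E UNIV V" and sub: "Pi\<^sub>E UNIV V \<subseteq> U"
      using op unfolding full_shift_def openin_product_topology_alt by auto
    define N where "N = nat (Max (insert 0 (abs ` {i. V i \<noteq> UNIV})))"
    have N: "\<bar>i\<bar> \<le> int N" if "V i \<noteq> UNIV" for i
    proof -
      have "\<bar>i\<bar> \<le> Max (insert 0 (abs ` {i. V i \<noteq> UNIV}))"
        using fin that by (intro Max_ge) auto
      then show ?thesis unfolding N_def by linarith
    qed
    have "y \<in> U" if "agree N x y" for y
    proof -
      have "y i \<in> V i" for i
        using that N[of i] x by (cases "V i = UNIV") (auto simp: agree_def PiE_UNIV_domain Pi_iff dest: spec[of _ i])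
      then show ?thesis using sub by (auto simp: PiE_UNIV_domain)
    qed
    then show "\<exists>N. \<forall>y. agree N x y \<longrightarrow> y \<in> U" by blast
  qed
next
  assume *: "\<forall>x\<in>U. \<exists>N. \<forall>y. agree N x y \<longrightarrow> y \<in> U"
  show "openin full_shift U"
    unfolding full_shift_def openin_product_topology_alt
  proof (intro ballI)
    fix x assume "x \<in> U"
    then obtain N where N: "\<And>y. agree N x y \<Longrightarrow> y \<in> U" using * by blast
    \<comment> \<open>The basic open box around \<open>x\<close> that pins exactly the coordinates of the window.\<close>
    let ?V = "\<lambda>i. if \<bar>i\<bar> \<le> int N then {x i} else UNIV"
    have "{i. ?V i \<noteq> UNIV} \<subseteq> {- int N..int N}" by auto
    then have "finite {i. ?V i \<noteq> UNIV}" by (rule finite_subset) simp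
    moreover have "Pi\<^sub>E UNIV ?V \<subseteq> U"
    proof
      fix y assume y: "y \<in> Pi\<^sub>E UNIV ?V"
      have "x i = y i" if "\<bar>i\<bar> \<le> int N" for i
        using PiE_mem[OF y, of i] that by simp
      then show "y \<in> U" by (intro N) (simp add: agree_def)
    qed
    moreover have "x \<in> Pi\<^sub>E UNIV ?V" by (simp add: PiE_UNIV_domain)
    ultimately show "\<exists>V. finite {i \<in> UNIV. V i \<noteq> topspace (discrete_topology UNIV)} \<and>
        (\<forall>i\<in>UNIV. openin (discrete_topology UNIV) (V i)) \<and> x \<in> Pi\<^sub>E UNIV V \<and> Pi\<^sub>E UNIV V \<subseteq> U"
      by (intro exI[of _ ?V]) simp
  qed
qed

lemma continuous_map_full_shiftI:
  assumes "\<And>x N. \<exists>M. \<forall>y. agree M x y \<longrightarrow> agree N (f x) (f y)"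
  shows "continuous_map full_shift full_shift f"
  unfolding continuous_map_def topspace_full_shift
proof (intro conjI allI impI)
  fix U :: "(int \<Rightarrow> 'b) set" assume U: "openin full_shift U"
  show "openin full_shift {x \<in> UNIV. f x \<in> U}"
    unfolding openin_full_shift_iff
  proof clarsimp
    fix x assume "f x \<in> U"
    then obtain N where N: "\<And>y. agree N (f x) y \<Longrightarrow> y \<in> U" using U by (auto simp: openin_full_shift_iff)
    obtain M where "\<forall>y. agree M x y \<longrightarrow> agree N (f x) (f y)" using assms by blast
    then show "\<exists>M. \<forall>y. agree M x y \<longrightarrow> f y \<in> U" using N by blast
  qed
qed simp

lemma compact_space_full_shift: "compact_space (full_shift :: (int \<Rightarrow> 'a::finite) topology)"
  by (simp add: full_shift_def compact_space_product_topology compact_space_discrete_topology)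

lemma Hausdorff_space_full_shift: "Hausdorff_space full_shift"
  by (simp add: full_shift_def Hausdorff_space_product_topology)

text \<open>
Closed sets are compact since the alphabet is finite, so images of closed sets are closed, hence
Borel. This is how images under \<^const>\<open>morphism_Z\<close> become test sets for the
transferred measure.
\<close>

lemma closedin_continuous_image:
  fixes f :: "(int \<Rightarrow> 'a::finite) \<Rightarrow> (int \<Rightarrow> 'b)"
  assumes "continuous_map full_shift full_shift f" "closedin full_shift K"
  shows "closedin full_shift (f ` K)"
proof -
  have "compactin full_shift K"
    using assms(2) by (intro closedin_compact_space compact_space_full_shift)
  then show ?thesis
    by (intro compactin_imp_closedin Hausdorff_space_full_shift image_compactin[OF _ assms(1)])
qed

section \<open>Borel sets and invariant measures\<close>

lemma space_borel_shift [simp]: "space borel_shift = UNIV"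
  by (simp add: borel_shift_def space_measure_of_conv)

lemma sets_borel_shift: "sets borel_shift = sigma_sets UNIV {U. openin full_shift U}"
  by (simp add: borel_shift_def)

lemma open_in_borel_shift: "openin full_shift U \<Longrightarrow> U \<in> sets borel_shift"
  by (simp add: sets_borel_shift sigma_sets.Basic)

lemma closed_in_borel_shift:
  assumes "closedin full_shift C" shows "C \<in> sets borel_shift"
proof -
  have "UNIV - C \<in> sets borel_shift"
    using assms by (intro open_in_borel_shift) (simp add: closedin_def)
  from sets.compl_sets[OF this] show ?thesis by (simp add: double_diff)
qed

lemma continuous_imp_measurable_borel_shift:
  assumes "continuous_map full_shift full_shift f"
  shows "f \<in> borel_shift \<rightarrow>\<^sub>M borel_shift"
  unfolding borel_shift_def[where 'a='b]
proof (rule measurable_measure_of)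
  show "f \<in> space borel_shift \<rightarrow> UNIV" by simp
  fix U :: "(int \<Rightarrow> 'b) set" assume "U \<in> {U. openin full_shift U}"
  then have "openin full_shift {x. f x \<in> U}" using assms by (simp add: continuous_map_def)
  then show "f -` U \<inter> space borel_shift \<in> sets borel_shift"
    by (simp add: open_in_borel_shift vimage_def)
qed simp

lemma singleton_in_borel_shift: "{x} \<in> sets borel_shift"
proof (rule closed_in_borel_shift)
  have "openin full_shift (UNIV - {x})"
    unfolding openin_full_shift_iff
  proof
    fix y assume "y \<in> UNIV - {x}"
    then obtain k where "y k \<noteq> x k" by auto
    then have "\<forall>z. agree (nat \<bar>k\<bar>) y z \<longrightarrow> z \<in> UNIV - {x}" by (auto simp: agree_def)
    then show "\<exists>N. \<forall>z. agree N y z \<longrightarrow> z \<in> UNIV - {x}" by blast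
  qed
  then show "closedin full_shift {x}" by (simp add: closedin_def)
qed

lemma countable_in_borel_shift: "countable C \<Longrightarrow> C \<in> sets borel_shift"
  using singleton_in_borel_shift by (rule sets.countable)

text \<open>
A set is local when membership is decided by a central window. Local sets are clopen and form
an algebra that generates the Borel sets; unlike cylinders, which are anchored at position 1,
they are closed under intersection for trivial reasons.
\<close>

definition local_set :: "nat \<Rightarrow> (int \<Rightarrow> 'a) set \<Rightarrow> bool" where
  "local_set N A \<longleftrightarrow> (\<forall>x y. agree N x y \<longrightarrow> x \<in> A \<longrightarrow> y \<in> A)"

lemma local_set_open: "local_set N A \<Longrightarrow> openin full_shift A"
  unfolding local_set_def openin_full_shift_iff by blast

lemma local_set_Compl: "local_set N A \<Longrightarrow> local_set N (- A)"
  unfolding local_set_def by (blast dest: agree_sym)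

lemma local_set_closed: "local_set N A \<Longrightarrow> closedin full_shift A"
  using local_set_open[OF local_set_Compl[of N A]] by (simp add: closedin_def Compl_eq_Diff_UNIV)

lemma local_set_borel: "local_set N A \<Longrightarrow> A \<in> sets borel_shift"
  by (simp add: open_in_borel_shift local_set_open)

lemma local_set_coordinates:
  assumes "\<And>k. k \<in> set ks \<Longrightarrow> \<bar>k\<bar> \<le> int N"
  shows "local_set N {x. map x ks = w}"
  unfolding local_set_def
proof (intro allI impI)
  fix x y :: "int \<Rightarrow> 'a" assume "agree N x y" "x \<in> {x. map x ks = w}"
  moreover have "map x ks = map y ks" using \<open>agree N x y\<close> assms by (simp add: agree_def)
  ultimately show "y \<in> {x. map x ks = w}" by simp
qed

lemma local_set_cylinder: "local_set (length w) (cylinder w)"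
  unfolding cylinder_def by (rule local_set_coordinates) auto

lemma agree_iff_map: "agree N x y \<longleftrightarrow> map x [- int N..int N] = map y [- int N..int N]"
  by (auto simp: agree_def abs_le_iff)

definition window :: "nat \<Rightarrow> 'a list \<Rightarrow> (int \<Rightarrow> 'a) set" where
  "window N v = {x. map x [- int N..int N] = v}"

lemma local_set_window: "local_set N (window N v)"
  unfolding window_def by (rule local_set_coordinates) auto

lemma local_set_eq_UN_window:
  assumes "local_set N A"
  shows "A = (\<Union>v\<in>(\<lambda>x. map x [- int N..int N]) ` A. window N v)"
proof
  show "A \<subseteq> (\<Union>v\<in>(\<lambda>x. map x [- int N..int N]) ` A. window N v)"
    unfolding window_def by blast
  show "(\<Union>v\<in>(\<lambda>x. map x [- int N..int N]) ` A. window N v) \<subseteq> A"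
  proof
    fix y assume "y \<in> (\<Union>v\<in>(\<lambda>x. map x [- int N..int N]) ` A. window N v)"
    then obtain x where "x \<in> A" "agree N x y" by (auto simp: window_def agree_iff_map simp del: map_eq_conv)
    then show "y \<in> A" using assms unfolding local_set_def by blast
  qed
qed

lemma finite_words: "finite ((\<lambda>x :: int \<Rightarrow> 'a::finite. map x [- int N..int N]) ` A)"
proof (rule finite_subset)
  show "(\<lambda>x. map x [- int N..int N]) ` A \<subseteq> {v. set v \<subseteq> UNIV \<and> length v = 2 * N + 1}" by auto
  show "finite {v :: 'a list. set v \<subseteq> UNIV \<and> length v = 2 * N + 1}"
    by (rule finite_lists_length_eq) simp
qed

text \<open>
The \<open>N\<close>-th set collects the points whose window \<open>{-N..N}\<close> already forces them into \<open>U\<close>.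
\<close>

lemma open_eq_UN_local:
  assumes "openin full_shift U"
  shows "\<exists>A. (\<forall>N. local_set N (A N)) \<and> U = (\<Union>N. A N)"
proof (intro exI conjI allI)
  let ?A = "\<lambda>N. {x. \<forall>y. agree N x y \<longrightarrow> y \<in> U}"
  show "local_set N (?A N)" for N
    unfolding local_set_def mem_Collect_eq by (meson agree_trans)
  show "U = (\<Union>N. ?A N)"
  proof
    show "U \<subseteq> (\<Union>N. ?A N)" using assms unfolding openin_full_shift_iff by blast
    show "(\<Union>N. ?A N) \<subseteq> U" using agree_refl by blast
  qed
qed

lemma sets_borel_shift_local: "sets borel_shift = sigma_sets UNIV {A. \<exists>N. local_set N A}"
proof
  show "sets borel_shift \<subseteq> sigma_sets UNIV {A :: (int \<Rightarrow> 'a) set. \<exists>N. local_set N A}"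
    unfolding sets_borel_shift
  proof (rule sigma_sets_mono, rule subsetI)
    fix U :: "(int \<Rightarrow> 'a) set" assume "U \<in> {U. openin full_shift U}"
    then obtain A where A: "\<And>N. local_set N (A N)" "U = (\<Union>N. A N)" using open_eq_UN_local by blast
    show "U \<in> sigma_sets UNIV {A. \<exists>N. local_set N A}"
      unfolding A(2) using A(1) by (intro sigma_sets.Union sigma_sets.Basic) blast
  qed
  show "sigma_sets UNIV {A :: (int \<Rightarrow> 'a) set. \<exists>N. local_set N A} \<subseteq> sets borel_shift"
    unfolding sets_borel_shift
    by (rule sigma_sets_mono') (auto intro: local_set_open)
qed

lemma continuous_map_translate: "continuous_map full_shift full_shift (\<lambda>x (k::int). x (k + m))"
proof (rule continuous_map_full_shiftI)
  fix x :: "int \<Rightarrow> 'a" and N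
  have "\<bar>k + m\<bar> \<le> int (N + nat \<bar>m\<bar>)" if "\<bar>k\<bar> \<le> int N" for k using that by linarith
  then have "\<forall>y. agree (N + nat \<bar>m\<bar>) x y \<longrightarrow> agree N (\<lambda>k. x (k + m)) (\<lambda>k. y (k + m))"
    unfolding agree_def by blast
  then show "\<exists>M. \<forall>y. agree M x y \<longrightarrow> agree N (\<lambda>k. x (k + m)) (\<lambda>k. y (k + m))" by blast
qed

lemma measurable_translate: "(\<lambda>x (k::int). x (k + m)) \<in> borel_shift \<rightarrow>\<^sub>M borel_shift"
  by (rule continuous_imp_measurable_borel_shift[OF continuous_map_translate])

lemma measurable_shift: "shift \<in> borel_shift \<rightarrow>\<^sub>M borel_shift"
  using measurable_translate[of 1] by (simp add: shift_def[abs_def])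

lemma vimage_in_borel_shift:
  "f \<in> borel_shift \<rightarrow>\<^sub>M borel_shift \<Longrightarrow> A \<in> sets borel_shift \<Longrightarrow> f -` A \<in> sets borel_shift"
  using measurable_sets[of f borel_shift borel_shift A] by simp

lemma invariant_measureD:
  assumes "\<mu> \<in> invariant_measures X"
  shows "sets \<mu> = sets borel_shift" "finite_measure \<mu>" "space \<mu> = UNIV"
    "A \<in> sets borel_shift \<Longrightarrow> emeasure \<mu> (shift -` A) = emeasure \<mu> A"
  using assms sets_eq_imp_space_eq[of \<mu> borel_shift] by (auto simp: invariant_measures_def)

lemma invariant_measures_mono: "X \<subseteq> Y \<Longrightarrow> invariant_measures X \<subseteq> invariant_measures Y"
  by (auto simp: invariant_measures_def)

lemma emeasure_translate_nat:
  assumes "\<mu> \<in> invariant_measures X" "A \<in> sets borel_shift"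
  shows "emeasure \<mu> {x. (\<lambda>k. x (k + int n)) \<in> A} = emeasure \<mu> A"
proof (induction n)
  case 0 then show ?case by simp
next
  case (Suc n)
  have *: "{x. (\<lambda>k. x (k + int n)) \<in> A} \<in> sets borel_shift"
    using vimage_in_borel_shift[OF measurable_translate assms(2)] by (simp add: vimage_def)
  have "{x. (\<lambda>k. x (k + int (Suc n))) \<in> A} = shift -` {x. (\<lambda>k. x (k + int n)) \<in> A}"
    by (auto simp: shift_def algebra_simps)
  then show ?case using invariant_measureD(4)[OF assms(1) *] Suc by simp
qed

text \<open>
Invariance under \<^const>\<open>shift\<close> is only stated for the forward shift; translating back by
\<open>-m\<close> reduces a negative translation to a positive one.
\<close>

lemma emeasure_translate:
  assumes "\<mu> \<in> invariant_measures X" "A \<in> sets borel_shift"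
  shows "emeasure \<mu> {x. (\<lambda>k. x (k + m)) \<in> A} = emeasure \<mu> A"
proof (cases "m \<ge> 0")
  case True
  then show ?thesis using emeasure_translate_nat[OF assms, of "nat m"] by simp
next
  case False
  have *: "{x. (\<lambda>k. x (k + m)) \<in> A} \<in> sets borel_shift"
    using vimage_in_borel_shift[OF measurable_translate assms(2)] by (simp add: vimage_def)
  have "emeasure \<mu> {x. (\<lambda>k. x (k + int (nat (- m)))) \<in> {x. (\<lambda>k. x (k + m)) \<in> A}} =
      emeasure \<mu> {x. (\<lambda>k. x (k + m)) \<in> A}"
    by (rule emeasure_translate_nat[OF assms(1) *])
  moreover have "{x. (\<lambda>k. x (k + int (nat (- m)))) \<in> {x. (\<lambda>k. x (k + m)) \<in> A}} = A"
    using False by simp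
  ultimately show ?thesis by simp
qed

lemma map_translate_upto: "map (\<lambda>k. f (k + m)) [i..j] = map f [i + m..j + (m::int)]"
proof (rule nth_equalityI)
  show "length (map (\<lambda>k. f (k + m)) [i..j]) = length (map f [i + m..j + m])" by simp
  fix n assume "n < length (map (\<lambda>k. f (k + m)) [i..j])"
  then show "map (\<lambda>k. f (k + m)) [i..j] ! n = map f [i + m..j + m] ! n"
    by (simp add: nth_upto algebra_simps)
qed

lemma emeasure_window:
  assumes "\<mu> \<in> invariant_measures X" "length v = 2 * N + 1"
  shows "emeasure \<mu> (window N v) = emeasure \<mu> (cylinder v)"
proof -
  \<comment> \<open>Translating by \<open>N + 1\<close> moves the window from \<open>{-N..N}\<close> to \<open>{1..2 N + 1}\<close>.\<close>
  have "{x. (\<lambda>k. x (k + int (N + 1))) \<in> window N v} = cylinder v"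
    unfolding window_def cylinder_def mem_Collect_eq map_translate_upto using assms(2) by (simp add: add.commute)
  then show ?thesis
    using emeasure_translate[OF assms(1) local_set_borel[OF local_set_window], of "int (N + 1)" N v] by simp
qed

text \<open>
A local set is a finite disjoint union of windows, and invariance moves each window to a cylinder
anchored at position 1. So the values on cylinders determine the measure on a generating
algebra.
\<close>

lemma invariant_measure_eqI:
  fixes \<mu> \<nu> :: "(int \<Rightarrow> 'a::finite) measure"
  assumes \<mu>: "\<mu> \<in> invariant_measures X" and \<nu>: "\<nu> \<in> invariant_measures Y"
    and eq: "\<And>w. w \<noteq> [] \<Longrightarrow> emeasure \<mu> (cylinder w) = emeasure \<nu> (cylinder w)"
  shows "\<mu> = \<nu>"
proof (rule measure_eqI_generator_eq[where \<Omega>=UNIV and E="{A. \<exists>N. local_set N A}" and A="\<lambda>_. UNIV"])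
  show "Int_stable {A :: (int \<Rightarrow> 'a) set. \<exists>N. local_set N A}"
  proof (rule Int_stableI, safe)
    fix A B :: "(int \<Rightarrow> 'a) set" and M N assume "local_set M A" "local_set N B"
    then have "local_set (max M N) (A \<inter> B)"
      unfolding local_set_def by (blast intro: agree_mono[of "max M N"] max.cobounded1 max.cobounded2)
    then show "\<exists>N. local_set N (A \<inter> B)" by blast
  qed
  show "sets \<mu> = sigma_sets UNIV {A. \<exists>N. local_set N A}" "sets \<nu> = sigma_sets UNIV {A. \<exists>N. local_set N A}"
    using invariant_measureD(1)[OF \<mu>] invariant_measureD(1)[OF \<nu>] by (simp_all add: sets_borel_shift_local)
  show "emeasure \<mu> UNIV \<noteq> \<infinity>"
    using finite_measure.emeasure_finite[OF invariant_measureD(2)[OF \<mu>]] by simp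
  show "range (\<lambda>_::nat. UNIV) \<subseteq> {A :: (int \<Rightarrow> 'a) set. \<exists>N. local_set N A}"
    by (auto simp: local_set_def)
  fix A :: "(int \<Rightarrow> 'a) set" assume "A \<in> {A. \<exists>N. local_set N A}"
  then obtain N where N: "local_set N A" by blast
  let ?V = "(\<lambda>x. map x [- int N..int N]) ` A"
  have fin: "finite ?V" by (rule finite_words)
  have sum: "emeasure \<rho> A = (\<Sum>v\<in>?V. emeasure \<rho> (cylinder v))" if \<rho>: "\<rho> \<in> invariant_measures Z" for \<rho> Z
  proof -
    have "(\<Sum>v\<in>?V. emeasure \<rho> (window N v)) = emeasure \<rho> (\<Union>v\<in>?V. window N v)"
    proof (rule sum_emeasure)
      show "window N ` ?V \<subseteq> sets \<rho>"
        using local_set_borel[OF local_set_window] invariant_measureD(1)[OF \<rho>] by auto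
      show "disjoint_family_on (window N) ?V" by (auto simp: disjoint_family_on_def window_def)
    qed (rule fin)
    also have "(\<Union>v\<in>?V. window N v) = A" by (rule local_set_eq_UN_window[OF N, symmetric])
    also have "(\<Sum>v\<in>?V. emeasure \<rho> (window N v)) = (\<Sum>v\<in>?V. emeasure \<rho> (cylinder v))"
      by (rule sum.cong) (auto intro!: emeasure_window[OF \<rho>])
    finally show ?thesis by simp
  qed
  have "(\<Sum>v\<in>?V. emeasure \<mu> (cylinder v)) = (\<Sum>v\<in>?V. emeasure \<nu> (cylinder v))"
    by (intro sum.cong eq) auto
  then show "emeasure \<mu> A = emeasure \<nu> A" using sum[OF \<mu>] sum[OF \<nu>] by simp
qed simp_all

text \<open>
There are only countably many windows, and every point outside the support lies in a null one.
\<close>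

lemma emeasure_Compl_support:
  fixes \<mu> :: "(int \<Rightarrow> 'a::finite) measure"
  assumes \<mu>: "\<mu> \<in> invariant_measures X" and X: "closedin full_shift X"
  shows "- X \<in> null_sets \<mu>"
proof -
  let ?I = "{(N, v). window N v \<in> null_sets \<mu>}"
  have "- X \<subseteq> (\<Union>(N, v)\<in>?I. window N v)"
  proof
    fix x assume "x \<in> - X"
    then have "x \<notin> measure_support \<mu>" using \<mu> by (auto simp: invariant_measures_def)
    then obtain U where U: "openin full_shift U" "x \<in> U" "emeasure \<mu> U = 0"
      by (auto simp: measure_support_def)
    then obtain N where "\<forall>y. agree N x y \<longrightarrow> y \<in> U" by (auto simp: openin_full_shift_iff)
    then have "window N (map x [- int N..int N]) \<subseteq> U" by (auto simp: window_def agree_iff_map)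
    moreover have "U \<in> null_sets \<mu>"
      using U open_in_borel_shift invariant_measureD(1)[OF \<mu>] by auto
    moreover have "window N (map x [- int N..int N]) \<in> sets \<mu>"
      using local_set_borel[OF local_set_window] invariant_measureD(1)[OF \<mu>] by simp
    ultimately have "window N (map x [- int N..int N]) \<in> null_sets \<mu>"
      by (meson null_sets_subset)
    then show "x \<in> (\<Union>(N, v)\<in>?I. window N v)" by (auto simp: window_def)
  qed
  moreover have "(\<Union>(N, v)\<in>?I. window N v) \<in> null_sets \<mu>"
    by (rule null_sets_UN') auto
  moreover have "- X \<in> sets \<mu>"
    using X open_in_borel_shift[of "- X"] invariant_measureD(1)[OF \<mu>]
    by (simp add: closedin_def Compl_eq_Diff_UNIV)
  ultimately show ?thesis by (meson null_sets_subset)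
qed

section \<open>The tower measure\<close>

lemma subshift_translate:
  assumes "subshift Y" "y \<in> Y"
  shows "(\<lambda>j. y (j + int k)) \<in> Y"
proof (induction k)
  case 0 then show ?case using assms(2) by simp
next
  case (Suc k)
  have "shift (\<lambda>j. y (j + int k)) \<in> Y" using Suc assms(1) unfolding subshift_def by blast
  then show ?case by (simp add: shift_def algebra_simps)
qed

lemma non_erasing_nonempty: "non_erasing \<sigma> \<Longrightarrow> \<sigma> [a] \<noteq> []"
  unfolding non_erasing_def by (metis list.size(3) not_one_le_zero)

lemma block_start_cong:
  assumes "\<And>i. min 1 n \<le> i \<Longrightarrow> i < max 1 n \<Longrightarrow> x i = y i"
  shows "block_start \<sigma> x n = block_start \<sigma> y n"
proof -
  have "(\<Sum>i\<in>{1..<n}. int (length (\<sigma> [x i]))) = (\<Sum>i\<in>{1..<n}. int (length (\<sigma> [y i])))"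
    "(\<Sum>i\<in>{n..<1}. int (length (\<sigma> [x i]))) = (\<Sum>i\<in>{n..<1}. int (length (\<sigma> [y i])))"
    using assms by (auto intro!: sum.cong)
  then show ?thesis by (simp add: block_start_def)
qed

text \<open>
Blocks have length at least 1, so the block that covers position \<open>j\<close> has an index of absolute
value at most \<open>\<bar>j\<bar>\<close>; no room is lost in passing from \<open>x\<close> to its image.
\<close>

lemma agree_morphism_Z:
  assumes ne: "non_erasing \<sigma>" and ag: "agree N x y"
  shows "agree N (morphism_Z \<sigma> x) (morphism_Z \<sigma> y)"
  unfolding agree_def
proof (intro allI impI)
  fix j assume j: "\<bar>j\<bar> \<le> int N"
  obtain n where n: "block_start \<sigma> x n \<le> j" "j < block_start \<sigma> x (n + 1)"
    using block_exists[OF ne] by blast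
  have nN: "\<bar>n\<bar> \<le> int N"
  proof (cases "n \<ge> 1")
    case True
    then show ?thesis using block_start_gap[OF ne, of 1 n x] n j by simp
  next
    case False
    then show ?thesis using block_start_gap[OF ne, of "n + 1" 1 x] n j by simp
  qed
  have xy: "x n = y n" using ag nN by (simp add: agree_def)
  have bs: "block_start \<sigma> x n = block_start \<sigma> y n"
    by (rule block_start_cong) (use ag nN in \<open>auto simp: agree_def\<close>)
  define i where "i = nat (j - block_start \<sigma> x n)"
  have ji: "j = block_start \<sigma> x n + int i" using n by (simp add: i_def)
  have il: "i < length (\<sigma> [x n])" using n ji by (simp add: block_start_Suc)
  show "morphism_Z \<sigma> x j = morphism_Z \<sigma> y j"
    using morphism_Z_block[OF ne, of i x n] morphism_Z_block[OF ne, of i y n] il xy bs ji by simp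
qed

lemma continuous_map_morphism_Z:
  "non_erasing \<sigma> \<Longrightarrow> continuous_map full_shift full_shift (morphism_Z \<sigma>)"
  by (rule continuous_map_full_shiftI) (blast intro: agree_morphism_Z)

text \<open>
Think of the tower of all pairs \<open>(x, k)\<close> with \<open>k < |\<sigma>(x\<^sub>1)|\<close>, mapped to the full shift over the
second alphabet by sending \<open>(x, k)\<close> to the \<open>k\<close>-fold shift of the image of \<open>x\<close>. The count is
the number of tower points above \<open>x\<close> that land in \<open>B\<close>.
\<close>

definition tower_count :: "('a list \<Rightarrow> 'b list) \<Rightarrow> (int \<Rightarrow> 'b) set \<Rightarrow> (int \<Rightarrow> 'a) \<Rightarrow> ennreal" where
  "tower_count \<sigma> B x =
     (\<Sum>k<length (\<sigma> [x 1]). indicator B (\<lambda>j. morphism_Z \<sigma> x (j + int k)))"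

text \<open>
The push-forward of the measure that \<open>\<mu>\<close> induces on the tower. It is shown below to be the
transferred measure.
\<close>

definition tower_measure :: "('a list \<Rightarrow> 'b list) \<Rightarrow> (int \<Rightarrow> 'a) measure \<Rightarrow> (int \<Rightarrow> 'b) measure" where
  "tower_measure \<sigma> \<mu> = measure_of UNIV (sets borel_shift) (\<lambda>B. \<integral>\<^sup>+x. tower_count \<sigma> B x \<partial>\<mu>)"

lemma measurable_morphism_Z_translate:
  assumes "non_erasing \<sigma>"
  shows "(\<lambda>x j. morphism_Z \<sigma> x (j + m)) \<in> borel_shift \<rightarrow>\<^sub>M borel_shift"
  using measurable_compose[OF continuous_imp_measurable_borel_shift[OF continuous_map_morphism_Z[OF assms]]
      measurable_translate[of m]] by simp

lemma measurable_letter: "(\<lambda>x. x k) \<in> borel_shift \<rightarrow>\<^sub>M count_space UNIV"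
proof (rule measurableI)
  fix A :: "'a set"
  have "local_set (nat \<bar>k\<bar>) {x. x k \<in> A}" by (simp add: local_set_def agree_def)
  then show "(\<lambda>x. x k) -` A \<inter> space borel_shift \<in> sets borel_shift"
    using local_set_borel by (simp add: vimage_def)
qed simp

lemma measurable_tower_count:
  fixes \<sigma> :: "'a::finite list \<Rightarrow> 'b list"
  assumes "non_erasing \<sigma>" "B \<in> sets borel_shift"
  shows "tower_count \<sigma> B \<in> borel_measurable borel_shift"
proof -
  have ind: "(\<lambda>x. indicator B (\<lambda>j. morphism_Z \<sigma> x (j + int k)) :: ennreal) \<in> borel_measurable borel_shift" for k
    using measurable_compose[OF measurable_morphism_Z_translate[OF assms(1)] borel_measurable_indicator[OF assms(2)]] .
  have "(\<lambda>x. (\<lambda>a x. \<Sum>k<length (\<sigma> [a]). indicator B (\<lambda>j. morphism_Z \<sigma> x (j + int k)) :: ennreal) (x 1) x)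
      \<in> borel_measurable borel_shift"
    by (rule measurable_compose_countable[OF _ measurable_letter]) (rule borel_measurable_sum, rule ind)
  then show ?thesis by (simp add: tower_count_def[abs_def])
qed

lemma sets_tower_measure [simp]: "sets (tower_measure (\<sigma> :: 'a list \<Rightarrow> 'b list) \<mu>) = sets borel_shift"
proof -
  have "sigma_sets UNIV (sets (borel_shift :: (int \<Rightarrow> 'b) measure)) = sets borel_shift"
    using sets.sigma_sets_eq[of "borel_shift :: (int \<Rightarrow> 'b) measure"] by simp
  then show ?thesis by (simp add: tower_measure_def)
qed

lemma emeasure_tower_measure:
  fixes \<sigma> :: "'a::finite list \<Rightarrow> 'b list"
  assumes ne: "non_erasing \<sigma>" and \<mu>: "sets \<mu> = sets borel_shift" and B: "B \<in> sets borel_shift"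
  shows "emeasure (tower_measure \<sigma> \<mu>) B = (\<integral>\<^sup>+x. tower_count \<sigma> B x \<partial>\<mu>)"
  unfolding tower_measure_def
proof (rule emeasure_measure_of_sigma)
  show "sigma_algebra UNIV (sets (borel_shift :: (int \<Rightarrow> 'b) measure))"
    using sets.sigma_algebra_axioms[of "borel_shift :: (int \<Rightarrow> 'b) measure"] by simp
  show "positive (sets borel_shift) (\<lambda>B. \<integral>\<^sup>+x. tower_count \<sigma> B x \<partial>\<mu>)"
    by (simp add: positive_def tower_count_def)
  show "countably_additive (sets borel_shift) (\<lambda>B. \<integral>\<^sup>+x. tower_count \<sigma> B x \<partial>\<mu>)"
  proof (rule countably_additiveI)
    fix A :: "nat \<Rightarrow> (int \<Rightarrow> 'b) set"
    assume A: "range A \<subseteq> sets borel_shift" "disjoint_family A"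
    have meas: "tower_count \<sigma> (A i) \<in> borel_measurable \<mu>" for i
      using measurable_tower_count[OF ne, of "A i"] A(1) measurable_cong_sets[OF \<mu> refl] by blast
    have "(\<Sum>i. \<integral>\<^sup>+x. tower_count \<sigma> (A i) x \<partial>\<mu>) = (\<integral>\<^sup>+x. (\<Sum>i. tower_count \<sigma> (A i) x) \<partial>\<mu>)"
      by (rule nn_integral_suminf[symmetric]) (rule meas)
    also have "(\<lambda>x. \<Sum>i. tower_count \<sigma> (A i) x) = tower_count \<sigma> (\<Union>i. A i)"
      by (simp add: fun_eq_iff tower_count_def suminf_sum suminf_indicator[OF A(2)])
    finally show "(\<Sum>i. \<integral>\<^sup>+x. tower_count \<sigma> (A i) x \<partial>\<mu>) = (\<integral>\<^sup>+x. tower_count \<sigma> (\<Union>i. A i) x \<partial>\<mu>)" .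
  qed
qed (rule B)

text \<open>
Shifting \<open>B\<close> moves every tower point up by one level. The bottom level is lost and the level just
above the top is gained; that one is the bottom level over \<open>shift x\<close>. So the two counts differ by a
coboundary, whose integral vanishes for an invariant measure.
\<close>

lemma tower_count_shift:
  assumes "non_erasing \<sigma>"
  shows "tower_count \<sigma> (shift -` B) x + indicator B (morphism_Z \<sigma> x) =
    tower_count \<sigma> B x + indicator B (morphism_Z \<sigma> (shift x))"
proof -
  define g :: "nat \<Rightarrow> ennreal" where "g k = indicator B (\<lambda>j. morphism_Z \<sigma> x (j + int k))" for k
  let ?L = "length (\<sigma> [x 1])"
  have "indicator (shift -` B) (\<lambda>j. morphism_Z \<sigma> x (j + int k)) = g (Suc k)" for k
    by (simp add: g_def indicator_def shift_def algebra_simps)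
  then have "tower_count \<sigma> (shift -` B) x = (\<Sum>k<?L. g (Suc k))" by (simp add: tower_count_def)
  moreover have "tower_count \<sigma> B x = (\<Sum>k<?L. g k)" by (simp add: tower_count_def g_def)
  moreover have "indicator B (morphism_Z \<sigma> x) = g 0" by (simp add: g_def)
  moreover have "indicator B (morphism_Z \<sigma> (shift x)) = g ?L"
    using morphism_Z_shift[OF assms, of x 1] block_start_Suc[of \<sigma> x 1] by (simp add: shift_def g_def)
  moreover have "(\<Sum>k<?L. g (Suc k)) + g 0 = (\<Sum>k<Suc ?L. g k)"
    unfolding sum.lessThan_Suc_shift by (simp add: add.commute)
  ultimately show ?thesis by simp
qed

lemma tower_measure_shift_invariant:
  fixes \<sigma> :: "'a::finite list \<Rightarrow> 'b list"
  assumes ne: "non_erasing \<sigma>" and \<mu>: "\<mu> \<in> invariant_measures X" and B: "B \<in> sets borel_shift"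
  shows "emeasure (tower_measure \<sigma> \<mu>) (shift -` B) = emeasure (tower_measure \<sigma> \<mu>) B"
proof -
  note inv = invariant_measureD[OF \<mu>]
  note meas_cong = measurable_cong_sets[OF inv(1) refl]
  let ?S = "{x. morphism_Z \<sigma> x \<in> B}"
  have sB: "shift -` B \<in> sets borel_shift" by (rule vimage_in_borel_shift[OF measurable_shift B])
  have S: "?S \<in> sets borel_shift"
    using vimage_in_borel_shift[OF continuous_imp_measurable_borel_shift[OF continuous_map_morphism_Z[OF ne]] B]
    by (simp add: vimage_def)
  have sS: "shift -` ?S \<in> sets borel_shift" by (rule vimage_in_borel_shift[OF measurable_shift S])
  have tm: "tower_count \<sigma> C \<in> borel_measurable \<mu>" if "C \<in> sets borel_shift" for C
    using measurable_tower_count[OF ne that] meas_cong by blast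
  have "emeasure (tower_measure \<sigma> \<mu>) (shift -` B) + emeasure \<mu> ?S =
      (\<integral>\<^sup>+x. tower_count \<sigma> (shift -` B) x + indicator ?S x \<partial>\<mu>)"
    using tm[OF sB] S inv(1) by (simp add: emeasure_tower_measure[OF ne inv(1) sB] nn_integral_add)
  also have "\<dots> = (\<integral>\<^sup>+x. tower_count \<sigma> B x + indicator (shift -` ?S) x \<partial>\<mu>)"
    using tower_count_shift[OF ne, of B] by (simp add: indicator_def)
  also have "\<dots> = emeasure (tower_measure \<sigma> \<mu>) B + emeasure \<mu> (shift -` ?S)"
    using tm[OF B] sS inv(1)
    by (simp add: emeasure_tower_measure[OF ne inv(1) B] nn_integral_add del: vimage_Collect_eq)
  also have "emeasure \<mu> (shift -` ?S) = emeasure \<mu> ?S" by (rule inv(4)[OF S])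
  finally show ?thesis
    using finite_measure.emeasure_finite[OF inv(2), of ?S] by (simp add: ennreal_add_left_cancel add.commute[of _ "emeasure \<mu> ?S"])
qed

lemma finite_tower_measure:
  fixes \<sigma> :: "'a::finite list \<Rightarrow> 'b list"
  assumes ne: "non_erasing \<sigma>" and \<mu>: "\<mu> \<in> invariant_measures X"
  shows "finite_measure (tower_measure \<sigma> \<mu>)"
proof (rule finite_measureI)
  note inv = invariant_measureD[OF \<mu>]
  define L where "L = Max (range (\<lambda>a. length (\<sigma> [a])))"
  have L: "length (\<sigma> [a]) \<le> L" for a unfolding L_def by (intro Max_ge) auto
  have "UNIV \<in> sets (borel_shift :: (int \<Rightarrow> 'b) measure)" using sets.top[of borel_shift] by simp
  from emeasure_tower_measure[OF ne inv(1) this]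
  have "emeasure (tower_measure \<sigma> \<mu>) UNIV = (\<integral>\<^sup>+x. of_nat (length (\<sigma> [x 1])) \<partial>\<mu>)"
    by (simp add: tower_count_def)
  also have "\<dots> \<le> (\<integral>\<^sup>+x. of_nat L \<partial>\<mu>)" by (rule nn_integral_mono) (simp add: L)
  also have "\<dots> < \<infinity>"
    using finite_measure.emeasure_finite[OF inv(2)] by (simp add: ennreal_mult_less_top top.not_eq_extremum less_top of_nat_less_top)
  finally have "emeasure (tower_measure \<sigma> \<mu>) UNIV \<noteq> \<infinity>" by simp
  moreover have "space (tower_measure \<sigma> \<mu>) = UNIV"
    using sets_eq_imp_space_eq[OF sets_tower_measure] by (metis space_borel_shift)
  ultimately show "emeasure (tower_measure \<sigma> \<mu>) (space (tower_measure \<sigma> \<mu>)) \<noteq> \<infinity>" by simp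
qed

text \<open>
Only the tower points above \<open>X\<close> matter for a measure supported in \<open>X\<close>. All later computations
with the tower measure evaluate the count on \<open>X\<close>, where orbit injectivity is available.
\<close>

lemma tower_measure_cong_on:
  fixes \<sigma> :: "'a::finite list \<Rightarrow> 'b list"
  assumes ne: "non_erasing \<sigma>" and \<mu>: "\<mu> \<in> invariant_measures X" and X: "closedin full_shift X"
    and B: "B \<in> sets borel_shift" and f: "\<And>x. x \<in> X \<Longrightarrow> tower_count \<sigma> B x = f x"
  shows "emeasure (tower_measure \<sigma> \<mu>) B = (\<integral>\<^sup>+x. f x \<partial>\<mu>)"
proof -
  have "AE x in \<mu>. x \<in> X"
    by (rule AE_I'[OF emeasure_Compl_support[OF \<mu> X]]) auto
  then have "AE x in \<mu>. tower_count \<sigma> B x = f x" by eventually_elim (rule f)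
  then show ?thesis
    unfolding emeasure_tower_measure[OF ne invariant_measureD(1)[OF \<mu>] B] by (rule nn_integral_cong_AE)
qed

lemma tower_measure_support:
  fixes \<sigma> :: "'a::finite list \<Rightarrow> 'b list"
  assumes ne: "non_erasing \<sigma>" and \<mu>: "\<mu> \<in> invariant_measures X" and X: "closedin full_shift X"
  shows "measure_support (tower_measure \<sigma> \<mu>) \<subseteq> image_subshift \<sigma> X"
  unfolding image_subshift_def
proof (intro Inter_greatest)
  fix Y assume "Y \<in> {Y. subshift Y \<and> morphism_Z \<sigma> ` X \<subseteq> Y}"
  then have Y: "subshift Y" "morphism_Z \<sigma> ` X \<subseteq> Y" by auto
  have op: "openin full_shift (- Y)"
    using Y(1) by (simp add: subshift_def closedin_def Compl_eq_Diff_UNIV)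
  have "tower_count \<sigma> (- Y) x = 0" if "x \<in> X" for x
    using subshift_translate[OF Y(1), of "morphism_Z \<sigma> x"] Y(2) that by (auto simp: tower_count_def)
  then have "emeasure (tower_measure \<sigma> \<mu>) (- Y) = (\<integral>\<^sup>+x. 0 \<partial>\<mu>)"
    by (rule tower_measure_cong_on[OF ne \<mu> X open_in_borel_shift[OF op]])
  then show "measure_support (tower_measure \<sigma> \<mu>) \<subseteq> Y"
    using op by (auto simp: measure_support_def)
qed

lemma tower_measure_invariant:
  fixes \<sigma> :: "'a::finite list \<Rightarrow> 'b list"
  assumes "non_erasing \<sigma>" "\<mu> \<in> invariant_measures X" "closedin full_shift X"
  shows "tower_measure \<sigma> \<mu> \<in> invariant_measures (image_subshift \<sigma> X)"
  using assms by (simp add: invariant_measures_def[of "image_subshift \<sigma> X"] finite_tower_measure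
      tower_measure_shift_invariant tower_measure_support)

section \<open>The cylinder formula\<close>

lemma cylinder_iff_nth: "x \<in> cylinder w \<longleftrightarrow> (\<forall>i<length w. x (1 + int i) = w ! i)"
  unfolding cylinder_def mem_Collect_eq list_eq_iff_nth_eq by simp

text \<open>
The subdivision is itself a non-erasing morphism with the same block lengths as \<open>\<sigma>\<close>. So the
bi-infinite subdivided sequence of \<open>x\<close> is \<open>morphism_Z (subdiv_morphism \<sigma>) x\<close>, and everything
known about \<^const>\<open>morphism_Z\<close> applies to it.
\<close>

lemma monoid_morphism_subdiv: "monoid_morphism (subdiv_morphism \<sigma>)"
  by (simp add: monoid_morphism_def subdiv_morphism_def)

lemma subdiv_morphism_Nil [simp]: "subdiv_morphism \<sigma> [] = []"
  by (simp add: subdiv_morphism_def)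

lemma subdiv_morphism_Cons: "subdiv_morphism \<sigma> (a # v) = subdiv_morphism \<sigma> [a] @ subdiv_morphism \<sigma> v"
  by (simp add: subdiv_morphism_def)

lemma length_subdiv_letter [simp]: "length (subdiv_morphism \<sigma> [a]) = length (\<sigma> [a])"
  by (simp add: subdiv_morphism_def del: upt_Suc)

lemma nth_subdiv_letter: "i < length (\<sigma> [a]) \<Longrightarrow> subdiv_morphism \<sigma> [a] ! i = (a, Suc i)"
  by (simp add: subdiv_morphism_def del: upt_Suc)

lemma non_erasing_subdiv: "non_erasing \<sigma> \<Longrightarrow> non_erasing (subdiv_morphism \<sigma>)"
  by (simp add: non_erasing_def)

lemma block_start_subdiv: "block_start (subdiv_morphism \<sigma>) x n = block_start \<sigma> x n"
  by (simp add: block_start_def)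

lemma length_ge_of_non_erasing:
  assumes "monoid_morphism \<sigma>" "non_erasing \<sigma>"
  shows "length v \<le> length (\<sigma> v)"
proof (induction v)
  case (Cons a v)
  have "\<sigma> (a # v) = \<sigma> [a] @ \<sigma> v" using assms(1) unfolding monoid_morphism_def by (metis append_Cons append_Nil)
  moreover have "1 \<le> length (\<sigma> [a])" using assms(2) by (simp add: non_erasing_def)
  ultimately show ?case using Cons by simp
qed simp

lemma block_start_length:
  assumes "monoid_morphism \<sigma>"
  shows "block_start \<sigma> x (1 + int n) = 1 + int (length (\<sigma> (map x [1..int n])))"
proof (induction n)
  case 0 then show ?case using assms by (simp add: monoid_morphism_def)
next
  case (Suc n)
  have "[1..int (Suc n)] = [1..int n] @ [1 + int n]" by (simp add: upto_rec2)
  then have "\<sigma> (map x [1..int (Suc n)]) = \<sigma> (map x [1..int n]) @ \<sigma> [x (1 + int n)]"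
    using assms by (simp add: monoid_morphism_def)
  then show ?case using Suc block_start_Suc[of \<sigma> x "1 + int n"] by (simp add: algebra_simps)
qed

lemma morphism_Z_nth:
  assumes mm: "monoid_morphism \<sigma>" and ne: "non_erasing \<sigma>"
  shows "q < length (\<sigma> (map x [1..int n])) \<Longrightarrow> morphism_Z \<sigma> x (1 + int q) = \<sigma> (map x [1..int n]) ! q"
proof (induction n)
  case 0 then show ?case using mm by (simp add: monoid_morphism_def)
next
  case (Suc n)
  let ?w = "map x [1..int n]" and ?b = "x (1 + int n)"
  have "[1..int (Suc n)] = [1..int n] @ [1 + int n]" by (simp add: upto_rec2)
  then have app: "\<sigma> (map x [1..int (Suc n)]) = \<sigma> ?w @ \<sigma> [?b]"
    using mm by (simp add: monoid_morphism_def)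
  show ?case
  proof (cases "q < length (\<sigma> ?w)")
    case True
    then show ?thesis using Suc.IH unfolding app by (simp add: nth_append)
  next
    case False
    have q: "1 + int q = block_start \<sigma> x (1 + int n) + int (q - length (\<sigma> ?w))"
      using False by (simp add: block_start_length[OF mm])
    have "q - length (\<sigma> ?w) < length (\<sigma> [?b])" using False Suc.prems unfolding app by simp
    from morphism_Z_block[of \<sigma> "q - length (\<sigma> ?w)" x "1 + int n", OF ne this] show ?thesis
      using False unfolding app q by (simp add: nth_append)
  qed
qed

lemma morphism_Z_subdiv:
  assumes ne: "non_erasing \<sigma>"
  obtains a i where "morphism_Z (subdiv_morphism \<sigma>) x j = (a, Suc i)" "i < length (\<sigma> [a])"
    "morphism_Z \<sigma> x j = \<sigma> [a] ! i"
proof -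
  obtain n where n: "block_start \<sigma> x n \<le> j" "j < block_start \<sigma> x (n + 1)"
    using block_exists[OF ne] by blast
  define i where "i = nat (j - block_start \<sigma> x n)"
  have j: "j = block_start \<sigma> x n + int i" using n by (simp add: i_def)
  have i: "i < length (\<sigma> [x n])" using n j by (simp add: block_start_Suc)
  show ?thesis
  proof (rule that[of "x n" i])
    show "morphism_Z (subdiv_morphism \<sigma>) x j = (x n, Suc i)"
      using morphism_Z_block[OF non_erasing_subdiv[OF ne], of i x n] i j
      by (simp add: block_start_subdiv nth_subdiv_letter)
    show "morphism_Z \<sigma> x j = \<sigma> [x n] ! i"
      using morphism_Z_block[OF ne, of i x n] i j by simp
  qed (rule i)
qed

lemma morphism_Z_subdiv_first_block:
  assumes "non_erasing \<sigma>" "k < length (\<sigma> [x 1])"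
  shows "morphism_Z (subdiv_morphism \<sigma>) x (1 + int k) = (x 1, Suc k)"
  using morphism_Z_block[OF non_erasing_subdiv[OF assms(1)], of k x 1] assms(2)
  by (simp add: nth_subdiv_letter)

text \<open>
The first letter of each subdivided block names the original letter. If \<open>t\<close> reaches into the last
block of \<open>v\<close>, it therefore spells out all letters of \<open>v\<close>. This is what makes the hat word unique.
\<close>

lemma prefix_if_common_subdiv_prefix:
  assumes ne: "non_erasing \<sigma>"
  shows "prefix t (subdiv_morphism \<sigma> v) \<Longrightarrow> prefix t (subdiv_morphism \<sigma> w) \<Longrightarrow>
    (v \<noteq> [] \<Longrightarrow> length (subdiv_morphism \<sigma> (butlast v)) < length t) \<Longrightarrow> prefix v w"
proof (induction v arbitrary: t w)
  case Nil then show ?case by simp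
next
  case (Cons b v)
  have pos: "0 < length (\<sigma> [c])" for c using non_erasing_nonempty[OF ne] by simp
  have t: "t \<noteq> []" using Cons.prems(3) by auto
  have first: "t ! 0 = (c, 1)" if "prefix t (subdiv_morphism \<sigma> (c # u))" for c u
  proof -
    have "t ! 0 = subdiv_morphism \<sigma> (c # u) ! 0"
      using that t by (auto simp: prefix_def nth_append)
    then show ?thesis using pos[of c] by (simp add: subdiv_morphism_Cons[of _ _ u] nth_append nth_subdiv_letter)
  qed
  obtain c w' where w: "w = c # w'" using Cons.prems(2) t by (cases w) auto
  have c: "c = b" using first[OF Cons.prems(1)] first[of c w'] Cons.prems(2) w by simp
  show ?case
  proof (cases "v = []")
    case True
    then show ?thesis using w c by simp
  next
    case False
    then have len: "length (\<sigma> [b]) + length (subdiv_morphism \<sigma> (butlast v)) < length t"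
      using Cons.prems(3) by (simp add: subdiv_morphism_Cons[of _ _ "butlast v"])
    have "\<not> prefix t (subdiv_morphism \<sigma> [b])"
      using len by (auto dest!: prefix_length_le)
    then obtain t' where t': "t = subdiv_morphism \<sigma> [b] @ t'" "prefix t' (subdiv_morphism \<sigma> v)"
      using Cons.prems(1) by (auto simp: subdiv_morphism_Cons[of _ _ v] prefix_append)
    have "prefix t' (subdiv_morphism \<sigma> w')"
      using Cons.prems(2) unfolding w c t'(1) by (simp add: subdiv_morphism_Cons[of _ _ w'])
    then have "prefix v w'"
      using Cons.IH[OF t'(2)] len t'(1) by simp
    then show ?thesis using w c by simp
  qed
qed

lemma hat_word:
  assumes "sublist u (subdiv_morphism \<sigma> v)"
  shows "sublist u (subdiv_morphism \<sigma> (hat_word \<sigma> u))"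
    "sublist u (subdiv_morphism \<sigma> v') \<Longrightarrow> length (hat_word \<sigma> u) \<le> length v'"
  unfolding hat_word_def
  using arg_min_natI[of "\<lambda>v. sublist u (subdiv_morphism \<sigma> v)" v length]
    arg_min_nat_le[of "\<lambda>v. sublist u (subdiv_morphism \<sigma> v)" v' length] assms by blast+

text \<open>
In an occurrence of \<open>u\<close> inside the subdivision of a shortest word, \<open>u\<close> starts in the first
block (else the first letter could be dropped) and ends in the last one (else the last letter could
be dropped). Its first letter \<open>a(i+1)\<close> then fixes the offset: exactly \<open>i\<close> letters of the block of
\<open>a\<close> precede it.
\<close>

lemma hat_word_position:
  assumes ne: "non_erasing \<sigma>" and ex: "\<exists>v. sublist u (subdiv_morphism \<sigma> v)"
    and u: "u = (a, Suc i) # u'" and i: "i < length (\<sigma> [a])"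
  obtains v' where "hat_word \<sigma> u = a # v'"
    "prefix (take i (subdiv_morphism \<sigma> [a]) @ u) (subdiv_morphism \<sigma> (hat_word \<sigma> u))"
    "length (subdiv_morphism \<sigma> (butlast (hat_word \<sigma> u))) < i + length u"
proof -
  let ?v = "hat_word \<sigma> u" and ?d = "subdiv_morphism \<sigma>"
  have sub: "sublist u (?d ?v)" and min: "\<And>w. sublist u (?d w) \<Longrightarrow> length ?v \<le> length w"
    using ex hat_word by blast+
  obtain p s where ps: "?d ?v = p @ u @ s" using sub by (auto simp: sublist_def)
  then obtain b v' where v: "?v = b # v'" using u by (cases ?v) auto
  have lp: "length p < length (\<sigma> [b])"
  proof (rule ccontr)
    assume "\<not> length p < length (\<sigma> [b])"
    then have "drop (length (\<sigma> [b])) (?d ?v) = drop (length (\<sigma> [b])) p @ u @ s" using ps by simp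
    moreover have "drop (length (\<sigma> [b])) (?d ?v) = ?d v'"
      unfolding v by (simp add: subdiv_morphism_Cons[of _ _ v'])
    ultimately have "sublist u (?d v')" by (auto simp: sublist_def)
    then show False using min[of v'] v by simp
  qed
  have "?d ?v ! length p = (b, Suc (length p))"
    using lp unfolding v by (simp add: subdiv_morphism_Cons[of _ _ v'] nth_append nth_subdiv_letter)
  moreover have "?d ?v ! length p = (a, Suc i)" using ps u by (simp add: nth_append)
  ultimately have b: "b = a" "length p = i" by auto
  have "p = take i (?d ?v)" using ps b by simp
  also have "\<dots> = take i (?d [a])" unfolding v b using i by (simp add: subdiv_morphism_Cons[of _ _ v'])
  finally have p: "p = take i (?d [a])" .
  show ?thesis
  proof (rule that[of v'])
    show "prefix (take i (?d [a]) @ u) (?d ?v)" using ps p by simp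
    show "length (?d (butlast ?v)) < i + length u"
    proof (rule ccontr)
      assume *: "\<not> length (?d (butlast ?v)) < i + length u"
      have "?d ?v = ?d (butlast ?v) @ ?d [last ?v]"
        using v monoid_morphism_subdiv[of \<sigma>] unfolding monoid_morphism_def
        by (metis append_butlast_last_id list.distinct(1))
      then have "?d (butlast ?v) = take (length (?d (butlast ?v))) (p @ u @ s)" using ps by simp
      also have "\<dots> = p @ u @ take (length (?d (butlast ?v)) - length p - length u) s"
        using * b by simp
      finally have "sublist u (?d (butlast ?v))" unfolding sublist_def by blast
      then show False using min[of "butlast ?v"] v by (simp del: butlast.simps)
    qed
  qed (use v b in simp)
qed

text \<open>
The set whose measure is \<^const>\<open>hat_mass\<close>, with the conventional value for words that do not
occur in any subdivision built in.
\<close>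

definition hat_set :: "('a list \<Rightarrow> 'b list) \<Rightarrow> ('a \<times> nat) list \<Rightarrow> (int \<Rightarrow> 'a) set" where
  "hat_set \<sigma> u = (if \<exists>v. sublist u (subdiv_morphism \<sigma> v) then cylinder (hat_word \<sigma> u) else {})"

text \<open>
If \<open>x\<close> starts with the hat word, its subdivided sequence starts with the subdivision of the hat word,
which contains \<open>u\<close> at offset \<open>i\<close>. Conversely, if \<open>u\<close> is read at offset \<open>i\<close>, then the first \<open>i\<close>
letters are forced by \<open>a\<close>, so the subdivisions of the hat word and of a long prefix of \<open>x\<close> have a
common prefix that ends in the last block of the hat word; hence the hat word is a prefix of \<open>x\<close>.
\<close>

lemma subdiv_reads_iff:
  assumes ne: "non_erasing \<sigma>" and u: "u = (a, Suc i) # u'" and i: "i < length (\<sigma> [a])"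
  shows "x \<in> hat_set \<sigma> u \<longleftrightarrow>
    x 1 = a \<and> (\<lambda>j. morphism_Z (subdiv_morphism \<sigma>) x (j + int i)) \<in> cylinder u"
proof
  let ?d = "subdiv_morphism \<sigma>" and ?v = "hat_word \<sigma> u"
  note mm = monoid_morphism_subdiv[of \<sigma>] and ned = non_erasing_subdiv[OF ne]
  {
    assume x: "x \<in> hat_set \<sigma> u"
    then have ex: "\<exists>v. sublist u (?d v)" and cyl: "map x [1..int (length ?v)] = ?v"
      by (auto simp: hat_set_def cylinder_def split: if_splits)
    from hat_word_position[OF ne ex u i] obtain v' where v: "?v = a # v'"
      and pre: "prefix (take i (?d [a]) @ u) (?d ?v)" by blast
    obtain s where s: "?d ?v = take i (?d [a]) @ u @ s" using pre by (auto simp: prefix_def)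
    have "x 1 = a" using cyl v nth_map[of 0 "[1..int (length ?v)]" x] by simp
    moreover have "morphism_Z ?d x (1 + int m + int i) = u ! m" if "m < length u" for m
    proof -
      have "morphism_Z ?d x (1 + int (i + m)) = ?d ?v ! (i + m)"
        using morphism_Z_nth[OF mm ned, of "i + m" x "length ?v"] that s i cyl by simp
      then show ?thesis using that s i by (simp add: nth_append algebra_simps)
    qed
    ultimately show "x 1 = a \<and> (\<lambda>j. morphism_Z ?d x (j + int i)) \<in> cylinder u"
      by (simp add: cylinder_iff_nth)
  next
    assume x: "x 1 = a \<and> (\<lambda>j. morphism_Z ?d x (j + int i)) \<in> cylinder u"
    \<comment> \<open>Blocks are non-empty, so \<open>N\<close> letters of \<open>x\<close> are enough to cover \<open>u\<close> at offset \<open>i\<close>.\<close>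
    define N where "N = i + length u"
    define v0 where "v0 = map x [1..int N]"
    have lenv: "N \<le> length (?d v0)"
      using length_ge_of_non_erasing[OF mm ned, of v0] by (simp add: v0_def)
    have "N \<noteq> 0" using u by (simp add: N_def)
    then have v0: "v0 = a # map x [2..int N]" using x by (simp add: v0_def upto_rec1)
    have "take N (?d v0) = take i (?d [a]) @ u"
    proof (rule nth_equalityI)
      show "length (take N (?d v0)) = length (take i (?d [a]) @ u)"
        using lenv i by (simp add: N_def)
      fix q assume "q < length (take N (?d v0))"
      then have q: "q < N" "q < length (?d v0)" by simp_all
      show "take N (?d v0) ! q = (take i (?d [a]) @ u) ! q"
      proof (cases "q < i")
        case True
        then show ?thesis using q i unfolding v0
          by (simp add: subdiv_morphism_Cons[of _ _ "map x [2..int N]"] nth_append)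
      next
        case False
        then have "u ! (q - i) = morphism_Z ?d x (1 + int q)"
          using x q by (auto simp: cylinder_iff_nth N_def dest!: spec[of _ "q - i"])
        also have "\<dots> = ?d v0 ! q"
          using morphism_Z_nth[OF mm ned, of q x N] q by (simp add: v0_def)
        finally show ?thesis using False q i by (simp add: nth_append)
      qed
    qed
    then have pre0: "prefix (take i (?d [a]) @ u) (?d v0)" by (metis take_is_prefix)
    then have ex: "\<exists>v. sublist u (?d v)" by (auto simp: prefix_def sublist_def)
    from hat_word_position[OF ne ex u i] have "prefix (take i (?d [a]) @ u) (?d ?v)"
      "length (?d (butlast ?v)) < i + length u" by blast+
    then have "prefix ?v v0"
      by (intro prefix_if_common_subdiv_prefix[OF ne _ pre0]) (use i in auto)
    then have "x \<in> cylinder ?v"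
      unfolding cylinder_iff_nth v0_def prefix_def by (auto simp: nth_append list_eq_iff_nth_eq)
    then show "x \<in> hat_set \<sigma> u" using ex by (simp add: hat_set_def)
  }
qed

text \<open>
The first letter of \<open>u\<close> determines the level from which \<open>u\<close> can be read, so the count is at most 1.
\<close>

lemma tower_count_subdiv:
  assumes ne: "non_erasing \<sigma>" and u: "u \<noteq> []" "u \<in> lists (subdiv_alphabet \<sigma>)"
  shows "tower_count (subdiv_morphism \<sigma>) (cylinder u) x = indicator (hat_set \<sigma> u) x"
proof -
  let ?d = "subdiv_morphism \<sigma>"
  obtain a i u' where u': "u = (a, Suc i) # u'" "i < length (\<sigma> [a])"
    using u by (cases u) (auto simp: subdiv_alphabet_def, metis Suc_le_D Suc_le_lessD One_nat_def)
  have *: "(\<lambda>j. morphism_Z ?d x (j + int k)) \<in> cylinder u \<longleftrightarrow> k = i \<and> x \<in> hat_set \<sigma> u"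
    if "k < length (\<sigma> [x 1])" for k
  proof -
    have "x 1 = a \<and> k = i" if "(\<lambda>j. morphism_Z ?d x (j + int k)) \<in> cylinder u"
      using that morphism_Z_subdiv_first_block[OF ne, of k x] \<open>k < length (\<sigma> [x 1])\<close> u'
      by (auto simp: cylinder_iff_nth dest: spec[of _ 0])
    then show ?thesis using subdiv_reads_iff[OF ne u', of x] by auto
  qed
  have "tower_count ?d (cylinder u) x = (\<Sum>k<length (\<sigma> [x 1]). if k = i then indicator (hat_set \<sigma> u) x else 0)"
    unfolding tower_count_def length_subdiv_letter
    by (rule sum.cong) (auto simp: indicator_def *)
  also have "\<dots> = indicator (hat_set \<sigma> u) x"
    using subdiv_reads_iff[OF ne u', of x] u'(2) by (auto simp: indicator_def)
  finally show ?thesis .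
qed

text \<open>
Each tower point from which \<open>w\<close> is read after collapsing reads exactly one subdivided word over
\<open>w\<close>.
\<close>

lemma tower_count_cylinder:
  fixes \<sigma> :: "'a::finite list \<Rightarrow> 'b list"
  assumes ne: "non_erasing \<sigma>"
  defines "U w \<equiv> {u \<in> lists (subdiv_alphabet \<sigma>). letter_morphism \<sigma> u = w}"
  shows "finite (U w)"
    "tower_count \<sigma> (cylinder w) x = (\<Sum>u\<in>U w. tower_count (subdiv_morphism \<sigma>) (cylinder u) x)"
proof -
  have "finite (SIGMA a:UNIV. {1..length (\<sigma> [a])})" by (intro finite_SigmaI) auto
  moreover have "subdiv_alphabet \<sigma> = (SIGMA a:UNIV. {1..length (\<sigma> [a])})"
    by (auto simp: subdiv_alphabet_def)
  ultimately have "finite {u. set u \<subseteq> subdiv_alphabet \<sigma> \<and> length u = length w}"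
    by (intro finite_lists_length_eq) simp
  then show fin: "finite (U w)"
    by (rule rev_finite_subset) (auto simp: U_def letter_morphism_def)
  let ?z = "\<lambda>k j. morphism_Z (subdiv_morphism \<sigma>) x (j + int k)"
  have "(indicator (cylinder w) (\<lambda>j. morphism_Z \<sigma> x (j + int k)) :: ennreal) =
      (\<Sum>u\<in>U w. indicator (cylinder u) (?z k))" for k
  proof -
    \<comment> \<open>The one subdivided word of the right length that is read from level \<open>k\<close>.\<close>
    let ?u = "map (?z k) [1..int (length w)]"
    have z: "?z k j \<in> subdiv_alphabet \<sigma>"
      "(case ?z k j of (a, i) \<Rightarrow> \<sigma> [a] ! (i - 1)) = morphism_Z \<sigma> x (j + int k)" for j
      by (rule morphism_Z_subdiv[OF ne, of x "j + int k"]; force simp: subdiv_alphabet_def)+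
    have mem: "?u \<in> U w \<longleftrightarrow> (\<lambda>j. morphism_Z \<sigma> x (j + int k)) \<in> cylinder w"
      using z by (auto simp: U_def letter_morphism_def cylinder_def comp_def)
    have "(\<Sum>u\<in>U w. indicator (cylinder u) (?z k)) = (\<Sum>u\<in>U w. if u = ?u then 1 else (0::ennreal))"
    proof (rule sum.cong)
      fix u assume "u \<in> U w"
      then have "length u = length w" by (auto simp: U_def letter_morphism_def)
      then show "indicator (cylinder u) (?z k) = (if u = ?u then 1 else (0::ennreal))"
        by (auto simp: indicator_def cylinder_def)
    qed simp
    also have "\<dots> = (if ?u \<in> U w then 1 else 0)" using fin by simp
    finally show ?thesis using mem by (simp add: indicator_def)
  qed
  then show "tower_count \<sigma> (cylinder w) x = (\<Sum>u\<in>U w. tower_count (subdiv_morphism \<sigma>) (cylinder u) x)"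
    by (simp add: tower_count_def sum.swap[of _ _ "U w"])
qed

lemma emeasure_tower_measure_cylinder:
  fixes \<sigma> :: "'a::finite list \<Rightarrow> 'b list"
  assumes ne: "non_erasing \<sigma>" and \<mu>: "sets \<mu> = sets borel_shift" and w: "w \<noteq> []"
  shows "emeasure (tower_measure \<sigma> \<mu>) (cylinder w) =
    (\<Sum>u \<in> {u \<in> lists (subdiv_alphabet \<sigma>). letter_morphism \<sigma> u = w}. hat_mass \<sigma> \<mu> u)"
proof -
  let ?U = "{u \<in> lists (subdiv_alphabet \<sigma>). letter_morphism \<sigma> u = w}"
  have H: "hat_set \<sigma> u \<in> sets \<mu>" for u
    using local_set_borel[OF local_set_cylinder, of "hat_word \<sigma> u"] \<mu> by (simp add: hat_set_def)
  have "tower_count \<sigma> (cylinder w) x = (\<Sum>u\<in>?U. indicator (hat_set \<sigma> u) x)" for x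
    unfolding tower_count_cylinder(2)[OF ne]
    using w by (intro sum.cong refl tower_count_subdiv[OF ne]) (auto simp: letter_morphism_def)
  then have "emeasure (tower_measure \<sigma> \<mu>) (cylinder w) = (\<integral>\<^sup>+x. (\<Sum>u\<in>?U. indicator (hat_set \<sigma> u) x) \<partial>\<mu>)"
    using emeasure_tower_measure[OF ne \<mu> local_set_borel[OF local_set_cylinder]] by simp
  also have "\<dots> = (\<Sum>u\<in>?U. emeasure \<mu> (hat_set \<sigma> u))"
    using H by (simp add: nn_integral_sum)
  also have "\<dots> = (\<Sum>u\<in>?U. hat_mass \<sigma> \<mu> u)"
    by (intro sum.cong refl) (simp add: hat_set_def hat_mass_def)
  finally show ?thesis .
qed

lemma measure_transfer_eq_tower_measure:
  fixes \<sigma> :: "'a::finite list \<Rightarrow> 'b::finite list"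
  assumes ne: "non_erasing \<sigma>" and \<mu>: "\<mu> \<in> invariant_measures X" and X: "closedin full_shift X"
  shows "measure_transfer \<sigma> \<mu> = tower_measure \<sigma> \<mu>"
  unfolding measure_transfer_def
proof (rule the_equality)
  note cyl = emeasure_tower_measure_cylinder[OF ne invariant_measureD(1)[OF \<mu>]]
  have inv: "tower_measure \<sigma> \<mu> \<in> invariant_measures UNIV"
    using tower_measure_invariant[OF ne \<mu> X] invariant_measures_mono by blast
  with cyl show "tower_measure \<sigma> \<mu> \<in> invariant_measures UNIV \<and> (\<forall>w. w \<noteq> [] \<longrightarrow>
      emeasure (tower_measure \<sigma> \<mu>) (cylinder w) =
        (\<Sum>u \<in> {u \<in> lists (subdiv_alphabet \<sigma>). letter_morphism \<sigma> u = w}. hat_mass \<sigma> \<mu> u))"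
    by blast
  fix \<nu> assume \<nu>: "\<nu> \<in> invariant_measures UNIV \<and> (\<forall>w. w \<noteq> [] \<longrightarrow> emeasure \<nu> (cylinder w) =
      (\<Sum>u \<in> {u \<in> lists (subdiv_alphabet \<sigma>). letter_morphism \<sigma> u = w}. hat_mass \<sigma> \<mu> u))"
  show "\<nu> = tower_measure \<sigma> \<mu>"
    by (rule invariant_measure_eqI[OF _ inv]) (use \<nu> cyl in auto)
qed

section \<open>Periodic points and orbits\<close>

definition periodic_points :: "(int \<Rightarrow> 'a) set" where
  "periodic_points = {y. \<exists>p>0. \<forall>k. y (k + p) = y k}"

lemma countable_periodic_points: "countable (periodic_points :: (int \<Rightarrow> 'a::finite) set)"
proof (rule countable_subset)
  let ?f = "\<lambda>(p :: int, l :: 'a list) k. l ! nat (k mod p)"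
  show "countable (range ?f)" by simp
  show "periodic_points \<subseteq> range ?f"
  proof
    fix y :: "int \<Rightarrow> 'a" assume "y \<in> periodic_points"
    then obtain p where p: "p > 0" and per: "\<And>k. y (k + p) = y k" by (auto simp: periodic_points_def)
    have mult: "y (k + m * p) = y k" for k m
    proof (induction m rule: int_induct[where k = 0])
      case (step1 i) then show ?case using per[of "k + i * p"] by (simp add: algebra_simps)
    next
      case (step2 i) then show ?case using per[of "k + (i - 1) * p"] by (simp add: algebra_simps)
    qed simp
    have "y k = ?f (p, map y [0..p - 1]) k" for k
    proof -
      have "y k = y (k mod p)" using mult[of "k mod p" "k div p"] by simp
      then show ?thesis using p by (simp add: nat_less_iff)
    qed
    then show "y \<in> range ?f" by blast
  qed
qed

lemma translate_eq_aperiodic: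
  assumes "y \<notin> periodic_points" and eq: "\<And>j. y (j + a) = y (j + b)"
  shows "a = b"
proof (rule ccontr)
  assume "a \<noteq> b"
  have "y (k + \<bar>a - b\<bar>) = y k" for k
    using eq[of "k - a"] eq[of "k - b"] by (cases "a \<le> b") (simp_all add: algebra_simps)
  then have "y \<in> periodic_points"
    using \<open>a \<noteq> b\<close> unfolding periodic_points_def by (intro CollectI exI[of _ "\<bar>a - b\<bar>"]) simp
  with assms(1) show False by simp
qed

lemma self_in_shift_orbit: "x \<in> shift_orbit x"
  unfolding shift_orbit_def by (rule range_eqI[of _ _ 0]) simp

lemma translate_in_shift_orbit: "(\<lambda>k. x (k + n)) \<in> shift_orbit x"
  unfolding shift_orbit_def by blast

lemma in_shift_orbitD: "y \<in> shift_orbit x \<Longrightarrow> shift_orbit y = shift_orbit x"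
  using shift_orbit_translate[of x] by (metis (no_types) rangeE shift_orbit_def)

lemma countable_shift_orbit: "countable (shift_orbit x)"
  by (simp add: shift_orbit_def)

lemma shift_orbit_morphism_Z:
  "non_erasing \<sigma> \<Longrightarrow> y \<in> shift_orbit x \<Longrightarrow> shift_orbit (morphism_Z \<sigma> y) = shift_orbit (morphism_Z \<sigma> x)"
  by (metis in_shift_orbitD orbit_map_shift_orbit)

section \<open>Injectivity on orbits and on measures\<close>

locale orbit_injective =
  fixes \<sigma> :: "'a::finite list \<Rightarrow> 'b::finite list" and X :: "(int \<Rightarrow> 'a) set"
  assumes non_erasing: "non_erasing \<sigma>" and closed: "closedin full_shift X"
    and inj: "inj_on (orbit_map \<sigma>) (shift_orbit ` X)"
begin

lemma same_orbit:
  assumes "x \<in> X" "y \<in> X" "shift_orbit (morphism_Z \<sigma> x) = shift_orbit (morphism_Z \<sigma> y)"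
  shows "shift_orbit x = shift_orbit y"
  using inj_onD[OF inj, of "shift_orbit x" "shift_orbit y"] assms
  by (simp add: orbit_map_shift_orbit[OF non_erasing])

text \<open>
Let \<open>x\<close> at level \<open>k\<close> and \<open>y\<close> at level 0 have the same image. Orbit injectivity gives
\<open>y = x(\<cdot> + m)\<close>, so the two tower points differ by a translation along a tower orbit; this translates
the image as well. If the image is aperiodic,
the translation is trivial. Periodic images are a genuine exception: the image of a periodic orbit
may have a smaller period than the tower orbit.
\<close>

lemma aperiodic_fibre:
  assumes xy: "x \<in> X" "y \<in> X" and k: "k < length (\<sigma> [x 1])"
    and eq: "(\<lambda>j. morphism_Z \<sigma> x (j + int k)) = morphism_Z \<sigma> y" and ap: "morphism_Z \<sigma> y \<notin> periodic_points"
  shows "x = y" "k = 0"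
proof -
  have "shift_orbit (morphism_Z \<sigma> x) = shift_orbit (morphism_Z \<sigma> y)"
    unfolding eq[symmetric] by (rule shift_orbit_translate[symmetric])
  then have "y \<in> shift_orbit x" using same_orbit[OF xy] self_in_shift_orbit[of y] by simp
  then obtain m where m: "y = (\<lambda>k. x (k + m))" unfolding shift_orbit_def by blast
  define d where "d = block_start \<sigma> x (1 + m) - 1"
  have my: "morphism_Z \<sigma> y = (\<lambda>j. morphism_Z \<sigma> x (j + d))"
    unfolding m d_def by (rule morphism_Z_shift[OF non_erasing])
  have "d - int k = 0"
  proof (rule translate_eq_aperiodic[OF ap])
    fix j
    show "morphism_Z \<sigma> y (j + (d - int k)) = morphism_Z \<sigma> y (j + 0)"
      using fun_cong[OF eq, of "j + (d - int k)"] fun_cong[OF my, of j] by simp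
  qed
  then have bs: "block_start \<sigma> x (1 + m) = 1 + int k" by (simp add: d_def)
  have bs2: "block_start \<sigma> x 2 = 1 + int (length (\<sigma> [x 1]))"
    using block_start_Suc[of \<sigma> x 1] by simp
  have "m = 0"
  proof (rule ccontr)
    assume "m \<noteq> 0"
    then consider "1 + m \<ge> 2" | "1 + m < 1" by linarith
    then show False
      using block_start_gap[OF non_erasing, of 2 "1 + m" x] block_start_gap[OF non_erasing, of "1 + m" 1 x]
        bs bs2 k by cases auto
  qed
  with bs show "x = y" "k = 0" by (simp_all add: m)
qed

lemma tower_count_orbit:
  assumes "x \<in> X" "y \<in> X"
  shows "tower_count \<sigma> (shift_orbit (morphism_Z \<sigma> x)) y =
    of_nat (length (\<sigma> [y 1])) * indicator (shift_orbit x) y"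
proof -
  have "(\<lambda>j. morphism_Z \<sigma> y (j + int k)) \<in> shift_orbit (morphism_Z \<sigma> x) \<longleftrightarrow> y \<in> shift_orbit x" for k
  proof
    assume "(\<lambda>j. morphism_Z \<sigma> y (j + int k)) \<in> shift_orbit (morphism_Z \<sigma> x)"
    then have "shift_orbit (morphism_Z \<sigma> y) = shift_orbit (morphism_Z \<sigma> x)"
      by (metis in_shift_orbitD shift_orbit_translate)
    then show "y \<in> shift_orbit x" using same_orbit[OF assms(2,1)] self_in_shift_orbit[of y] by simp
  next
    assume "y \<in> shift_orbit x"
    then show "(\<lambda>j. morphism_Z \<sigma> y (j + int k)) \<in> shift_orbit (morphism_Z \<sigma> x)"
      using translate_in_shift_orbit shift_orbit_morphism_Z[OF non_erasing] by metis
  qed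
  then show ?thesis by (simp add: tower_count_def indicator_def)
qed

end

lemma emeasure_orbit_singleton:
  assumes \<mu>: "\<mu> \<in> invariant_measures X" and y: "y \<in> shift_orbit x"
  shows "emeasure \<mu> {y} = emeasure \<mu> {x}"
proof -
  obtain n where n: "y = (\<lambda>k. x (k + n))" using y unfolding shift_orbit_def by blast
  have "{z. (\<lambda>k. z (k + n)) \<in> {y}} = {x}"
  proof -
    have "z = x" if "(\<lambda>k. z (k + n)) = y" for z
    proof
      fix k show "z k = x k" using fun_cong[OF that, of "k - n"] n by simp
    qed
    then show ?thesis using n by auto
  qed
  then show ?thesis using emeasure_translate[OF \<mu> singleton_in_borel_shift, of n y] by simp
qed

text \<open>
All points of an orbit have the same mass, and the total mass is finite.
\<close>

lemma emeasure_infinite_orbit: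
  assumes \<mu>: "\<mu> \<in> invariant_measures X" and inf: "infinite (shift_orbit x)"
  shows "emeasure \<mu> {x} = 0"
proof (rule ccontr)
  assume "emeasure \<mu> {x} \<noteq> 0"
  interpret finite_measure \<mu> by (rule invariant_measureD(2)[OF \<mu>])
  have sing: "{y} \<in> sets \<mu>" for y using singleton_in_borel_shift invariant_measureD(1)[OF \<mu>] by simp
  have pos: "measure \<mu> {x} > 0"
    using \<open>emeasure \<mu> {x} \<noteq> 0\<close> by (simp add: emeasure_eq_measure zero_less_measure_iff)
  obtain n :: nat where n: "measure \<mu> UNIV < of_nat n * measure \<mu> {x}" using reals_Archimedean3[OF pos] by blast
  obtain F where F: "finite F" "card F = n" "F \<subseteq> shift_orbit x"
    using infinite_arbitrarily_large[OF inf] by blast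
  have "measure \<mu> F = (\<Sum>y\<in>F. measure \<mu> {y})"
    using F(1) sing by (intro finite_measure_eq_sum_singleton) auto
  also have "\<dots> = (\<Sum>y\<in>F. measure \<mu> {x})"
    using F(3) emeasure_orbit_singleton[OF \<mu>] by (intro sum.cong) (auto simp: measure_def)
  also have "\<dots> = of_nat n * measure \<mu> {x}" using F(2) by simp
  finally have "measure \<mu> F = of_nat n * measure \<mu> {x}" .
  moreover have "measure \<mu> F \<le> measure \<mu> UNIV"
    using bounded_measure[of F] invariant_measureD(3)[OF \<mu>] by simp
  ultimately show False using n by simp
qed

context orbit_injective
begin

text \<open>
By orbit injectivity the tower points over the orbit of \<open>x\<close> are exactly those that land in the
orbit of the image of \<open>x\<close>. So the transferred mass of the image orbit is the mass of \<open>{x}\<close> times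
the number of tower points over the orbit of \<open>x\<close>, if that orbit is finite; otherwise both masses of
\<open>{x}\<close> vanish.
\<close>

lemma singletons_eq:
  assumes \<mu>: "\<mu> \<in> invariant_measures X" and \<nu>: "\<nu> \<in> invariant_measures X"
    and eq: "tower_measure \<sigma> \<mu> = tower_measure \<sigma> \<nu>" and x: "x \<in> X"
  shows "emeasure \<mu> {x} = emeasure \<nu> {x}"
proof (cases "finite (shift_orbit x)")
  case False
  then show ?thesis using emeasure_infinite_orbit \<mu> \<nu> by metis
next
  case True
  define c :: ennreal where "c = (\<Sum>y\<in>shift_orbit x. of_nat (length (\<sigma> [y 1])))"
  have O: "shift_orbit (morphism_Z \<sigma> x) \<in> sets borel_shift"
    by (rule countable_in_borel_shift[OF countable_shift_orbit])
  have *: "emeasure (tower_measure \<sigma> \<rho>) (shift_orbit (morphism_Z \<sigma> x)) = c * emeasure \<rho> {x}"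
    if \<rho>: "\<rho> \<in> invariant_measures X" for \<rho>
  proof -
    have "emeasure (tower_measure \<sigma> \<rho>) (shift_orbit (morphism_Z \<sigma> x)) =
        (\<integral>\<^sup>+y. of_nat (length (\<sigma> [y 1])) * indicator (shift_orbit x) y \<partial>\<rho>)"
      by (rule tower_measure_cong_on[OF non_erasing \<rho> closed O tower_count_orbit[OF x]])
    also have "\<dots> = (\<Sum>y\<in>shift_orbit x. of_nat (length (\<sigma> [y 1])) * emeasure \<rho> {y})"
      using True singleton_in_borel_shift invariant_measureD(1)[OF \<rho>]
      by (intro nn_integral_indicator_finite) auto
    also have "\<dots> = (\<Sum>y\<in>shift_orbit x. of_nat (length (\<sigma> [y 1])) * emeasure \<rho> {x})"
      by (intro sum.cong refl arg_cong2[where f="(*)"] emeasure_orbit_singleton[OF \<rho>])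
    finally show ?thesis by (simp add: c_def sum_distrib_right)
  qed
  have "c \<noteq> 0"
    using True self_in_shift_orbit[of x] non_erasing_nonempty[OF non_erasing] by (auto simp: c_def)
  moreover have "c \<noteq> \<infinity>" using True by (simp add: c_def)
  ultimately show ?thesis
    using *[OF \<mu>] *[OF \<nu>] eq by (simp add: ennreal_mult_cancel_left)
qed

text \<open>
Away from the periodic points the image of \<open>K\<close> is hit only by the points of \<open>K\<close>, once each and from
the bottom level, so it sees exactly the \<open>\<mu>\<close>-mass of that part of \<open>K\<close>.
\<close>

lemma aperiodic_part:
  assumes \<mu>: "\<mu> \<in> invariant_measures X" and K: "closedin full_shift K" "K \<subseteq> X"
  shows "emeasure (tower_measure \<sigma> \<mu>) (morphism_Z \<sigma> ` K - periodic_points) =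
    emeasure \<mu> (K - {x. morphism_Z \<sigma> x \<in> periodic_points})"
proof -
  let ?B = "morphism_Z \<sigma> ` K - periodic_points" and ?A = "K - {x. morphism_Z \<sigma> x \<in> periodic_points}"
  note cont = continuous_map_morphism_Z[OF non_erasing]
  have per: "periodic_points \<in> sets (borel_shift :: (int \<Rightarrow> 'b) measure)"
    by (rule countable_in_borel_shift[OF countable_periodic_points])
  have B: "?B \<in> sets borel_shift"
    by (intro sets.Diff per closed_in_borel_shift closedin_continuous_image[OF cont K(1)])
  have "{x. morphism_Z \<sigma> x \<in> periodic_points} \<in> sets borel_shift"
    using vimage_in_borel_shift[OF continuous_imp_measurable_borel_shift[OF cont] per] by (simp add: vimage_def)
  then have A: "?A \<in> sets borel_shift"
    by (rule sets.Diff[OF closed_in_borel_shift[OF K(1)]])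
  have count: "tower_count \<sigma> ?B x = indicator ?A x" if x: "x \<in> X" for x
  proof -
    have *: "(\<lambda>j. morphism_Z \<sigma> x (j + int k)) \<in> ?B \<longleftrightarrow> k = 0 \<and> x \<in> ?A" if k: "k < length (\<sigma> [x 1])" for k
    proof
      assume B: "(\<lambda>j. morphism_Z \<sigma> x (j + int k)) \<in> ?B"
      then obtain y where y: "y \<in> K" "(\<lambda>j. morphism_Z \<sigma> x (j + int k)) = morphism_Z \<sigma> y" by blast
      then have "morphism_Z \<sigma> y \<notin> periodic_points" using B by simp
      then show "k = 0 \<and> x \<in> ?A"
        using aperiodic_fibre[OF x _ k y(2)] y(1) K(2) by blast
    qed auto
    have "tower_count \<sigma> ?B x = (\<Sum>k<length (\<sigma> [x 1]). if k = 0 then indicator ?A x else 0)"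
      unfolding tower_count_def
    proof (rule sum.cong)
      fix k assume "k \<in> {..<length (\<sigma> [x 1])}"
      then show "indicator ?B (\<lambda>j. morphism_Z \<sigma> x (j + int k)) = (if k = 0 then indicator ?A x else (0::ennreal))"
        using *[of k] unfolding indicator_def by auto
    qed simp
    also have "\<dots> = indicator ?A x" using non_erasing_nonempty[OF non_erasing] by simp
    finally show ?thesis .
  qed
  have "emeasure (tower_measure \<sigma> \<mu>) ?B = (\<integral>\<^sup>+x. indicator ?A x \<partial>\<mu>)"
    by (rule tower_measure_cong_on[OF non_erasing \<mu> closed B count])
  then show ?thesis using A invariant_measureD(1)[OF \<mu>] by simp
qed

text \<open>
There are countably many periodic points over a finite alphabet, and orbit injectivity puts
all preimages of one of them into a single orbit.
\<close>

lemma countable_periodic_preimage: "countable {x \<in> X. morphism_Z \<sigma> x \<in> periodic_points}"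
proof -
  have "countable {x \<in> X. morphism_Z \<sigma> x = y}" for y
  proof (cases "{x \<in> X. morphism_Z \<sigma> x = y} = {}")
    case False
    then obtain x where x: "x \<in> X" "morphism_Z \<sigma> x = y" by blast
    have "{x \<in> X. morphism_Z \<sigma> x = y} \<subseteq> shift_orbit x"
    proof
      fix z assume "z \<in> {x \<in> X. morphism_Z \<sigma> x = y}"
      then show "z \<in> shift_orbit x" using same_orbit[of z x] x self_in_shift_orbit[of z] by simp
    qed
    then show ?thesis using countable_shift_orbit by (rule countable_subset)
  next
    case True then show ?thesis by (simp only: countable_empty)
  qed
  then have "countable (\<Union>y\<in>periodic_points. {x \<in> X. morphism_Z \<sigma> x = y})"
    by (intro countable_UN countable_periodic_points)
  moreover have "(\<Union>y\<in>periodic_points. {x \<in> X. morphism_Z \<sigma> x = y}) = {x \<in> X. morphism_Z \<sigma> x \<in> periodic_points}"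
    by auto
  ultimately show ?thesis by simp
qed

text \<open>
A cylinder splits, within \<open>X\<close>, into the points with aperiodic image, whose mass is read off from the
transferred measure at once, and countably many points with periodic image, whose masses are
recovered one by one.
\<close>

lemma tower_measure_injective:
  assumes \<mu>: "\<mu> \<in> invariant_measures X" and \<nu>: "\<nu> \<in> invariant_measures X"
    and eq: "tower_measure \<sigma> \<mu> = tower_measure \<sigma> \<nu>"
  shows "\<mu> = \<nu>"
proof (rule invariant_measure_eqI[OF \<mu> \<nu>])
  fix w :: "'a list"
  let ?K = "X \<inter> cylinder w" and ?P = "{x. morphism_Z \<sigma> x \<in> periodic_points}"
  have K: "closedin full_shift ?K"
    by (intro closedin_Int closed local_set_closed[OF local_set_cylinder])
  have KP: "countable (?K \<inter> ?P)"
    by (rule countable_subset[OF _ countable_periodic_preimage]) auto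
  note KPs = countable_in_borel_shift[OF KP]
  have split: "emeasure \<rho> (cylinder w) =
      emeasure (tower_measure \<sigma> \<rho>) (morphism_Z \<sigma> ` ?K - periodic_points) +
      (\<integral>\<^sup>+x. emeasure \<rho> {x} \<partial>count_space (?K \<inter> ?P))"
    if \<rho>: "\<rho> \<in> invariant_measures X" for \<rho>
  proof -
    note s = invariant_measureD(1)[OF \<rho>]
    have Ks: "?K \<in> sets \<rho>" using closed_in_borel_shift[OF K] s by simp
    have "emeasure \<rho> (cylinder w) = emeasure \<rho> ?K"
    proof (rule emeasure_eq_AE)
      show "AE x in \<rho>. x \<in> cylinder w \<longleftrightarrow> x \<in> ?K"
        by (rule AE_I'[OF emeasure_Compl_support[OF \<rho> closed]]) auto
    qed (use Ks s local_set_borel[OF local_set_cylinder, of w] in simp_all)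
    also have "\<dots> = emeasure \<rho> ((?K - ?P) \<union> (?K \<inter> ?P))" by (simp add: Un_Diff_Int)
    also have "\<dots> = emeasure \<rho> (?K - ?P) + emeasure \<rho> (?K \<inter> ?P)"
    proof (rule plus_emeasure[symmetric])
      have "?K - ?P = ?K - (?K \<inter> ?P)" by blast
      then show "?K - ?P \<in> sets \<rho>" using Ks KPs s by (metis sets.Diff)
    qed (use KPs s in auto)
    also have "emeasure \<rho> (?K - ?P) = emeasure (tower_measure \<sigma> \<rho>) (morphism_Z \<sigma> ` ?K - periodic_points)"
      by (rule aperiodic_part[OF \<rho> K, symmetric]) simp
    also have "emeasure \<rho> (?K \<inter> ?P) = (\<integral>\<^sup>+x. emeasure \<rho> {x} \<partial>count_space (?K \<inter> ?P))"
      by (rule emeasure_countable_singleton[OF _ KP]) (simp add: s singleton_in_borel_shift)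
    finally show ?thesis .
  qed
  have "(\<integral>\<^sup>+x. emeasure \<mu> {x} \<partial>count_space (?K \<inter> ?P)) = (\<integral>\<^sup>+x. emeasure \<nu> {x} \<partial>count_space (?K \<inter> ?P))"
    by (rule nn_integral_cong) (simp add: singletons_eq[OF \<mu> \<nu> eq])
  then show "emeasure \<mu> (cylinder w) = emeasure \<nu> (cylinder w)"
    using split[OF \<mu>] split[OF \<nu>] eq by simp
qed

end

theorem theorem1p5:
  fixes \<sigma> :: "'a::finite list \<Rightarrow> 'b::finite list" and X :: "(int \<Rightarrow> 'a) set"
  assumes "monoid_morphism \<sigma>" and "non_erasing \<sigma>"
    and "subshift X"
    and "inj_on (orbit_map \<sigma>) (shift_orbit ` X)"
  shows "measure_transfer \<sigma> \<in> invariant_measures X \<rightarrow> invariant_measures (image_subshift \<sigma> X)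
    \<and> inj_on (measure_transfer \<sigma>) (invariant_measures X)"
proof -
  have X: "closedin full_shift X" using assms(3) by (simp add: subshift_def)
  interpret orbit_injective \<sigma> X using assms X by unfold_locales
  have eq: "measure_transfer \<sigma> \<mu> = tower_measure \<sigma> \<mu>" if "\<mu> \<in> invariant_measures X" for \<mu>
    by (rule measure_transfer_eq_tower_measure[OF assms(2) that X])
  show ?thesis
  proof
    show "measure_transfer \<sigma> \<in> invariant_measures X \<rightarrow> invariant_measures (image_subshift \<sigma> X)"
      using eq tower_measure_invariant[OF assms(2) _ X] by simp
    show "inj_on (measure_transfer \<sigma>) (invariant_measures X)"
      by (rule inj_onI) (simp add: eq tower_measure_injective)
  qed
qed

end
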